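(* Let $\Bbbk$ be an algebraically closed field of characteristic $0$, let $\mathfrak q$ be the Lie algebra of a connected affine algebraic group over $\Bbbk$, let $\mathfrak f\subset\mathfrak q$ be a Lie subalgebra, and suppose that $\mathfrak q=\mathfrak f\oplus\mathfrak m$ is a vector space decomposition with $[\mathfrak f,\mathfrak m]\subset\mathfrak m$. Let $\mathcal Z=\mathcal Z_{(\mathfrak q,\mathfrak f)}$ be the subalgebra of the symmetric algebra $\mathcal S(\mathfrak q)$ generated by the bi-homogeneous components (with respect to $\mathfrak q=\mathfrak f\oplus\mathfrak m$) of all $H\in\mathcal S(\mathfrak q)^{\mathfrak q}$. Then $\mathcal Z$ is Poisson commutative if and only if $$\gamma_{\mathfrak f}\bigl(\bigl[(d_{\varphi_s(\gamma)}H)_{\mathfrak f},\,(d_{\varphi_{s'}(\gamma)}H')_{\mathfrak f}\bigr]\bigr)=0$$ for each $\gamma\in\mathfrak q^*$, all nonzero $s,s'\in\Bbbk$, and all $H,H'\in\mathcal S(\mathfrak q)^{\mathfrak q}$.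
   Context: $\mathcal S(\mathfrak q)$ is identified with the algebra $\Bbbk[\mathfrak q^*]$ of polynomial functions on $\mathfrak q^*$ and carries the Lie--Poisson bracket $\{\cdot,\cdot\}$, the Poisson bracket determined by $\{x,y\}=[x,y]$ for $x,y\in\mathfrak q$. A subalgebra $A\subset\mathcal S(\mathfrak q)$ is Poisson commutative if $\{A,A\}=0$. $\mathcal S(\mathfrak q)^{\mathfrak q}=\{H\in\mathcal S(\mathfrak q)\mid \{H,x\}=0\ \forall x\in\mathfrak q\}$. For $F\in\mathcal S(\mathfrak q)$ and $\gamma\in\mathfrak q^*$, $d_\gamma F\in\mathfrak q$ is the differential of $F$ at $\gamma$ (using $(\mathfrak q^* )^*=\mathfrak q$). The decomposition $\mathfrak q=\mathfrak f\oplus\mathfrak m$ gives $\mathcal S(\mathfrak q)=\bigoplus_{i,j\ge 0}\mathcal S^i(\mathfrak f)\otimes\mathcal S^j(\mathfrak m)$; accordingly every $H\in\mathcal S(\mathfrak q)$ is written $H=\sum_{i,j}H_{(i,j)}$ with $H_{(i,j)}\in\mathcal S^i(\mathfrak f)\otimes\mathcal S^j(\mathfrak m)$, and the $H_{(i,j)}$ are its bi-homogeneous components. For $x\in\mathfrak q$, $x_{\mathfrak f}\in\mathfrak f$ and $x_{\mathfrak m}\in\mathfrak m$ are its components, $x=x_{\mathfrak f}+x_{\mathfrak m}$. For $\gamma\in\mathfrak q^*$ write $\gamma=\gamma_{\mathfrak f}+\gamma_{\mathfrak m}$ with $\gamma_{\mathfrak f}|_{\mathfrak m}=0$ and $\gamma_{\mathfrak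 m}|_{\mathfrak f}=0$, and set $\varphi_s(\gamma)=\gamma_{\mathfrak f}+s\gamma_{\mathfrak m}$ for $s\in\Bbbk$. *)

theory Defs
  imports "HOL-Computational_Algebra.Polynomial" "HOL-Algebra.Group"
begin

section \<open>Algebras of functions\<close>

text \<open>
  A function on a set \<open>D\<close> is represented by its extension by zero to the whole type, so that
  equality of functions on \<open>D\<close> is equality in HOL.
\<close>

definition fun_on :: "'p set \<Rightarrow> ('p \<Rightarrow> 'k) \<Rightarrow> 'p \<Rightarrow> 'k::zero" where
  "fun_on D f = (\<lambda>p. if p \<in> D then f p else 0)"

inductive_set gen_algebra :: "'p set \<Rightarrow> ('p \<Rightarrow> 'k::field) set \<Rightarrow> ('p \<Rightarrow> 'k) set"
  for D :: "'p set" and X :: "('p \<Rightarrow> 'k::field) set" where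
  const: "fun_on D (\<lambda>_. c) \<in> gen_algebra D X"
| gen: "F \<in> X \<Longrightarrow> F \<in> gen_algebra D X"
| add: "F \<in> gen_algebra D X \<Longrightarrow> G \<in> gen_algebra D X \<Longrightarrow> (\<lambda>p. F p + G p) \<in> gen_algebra D X"
| mult: "F \<in> gen_algebra D X \<Longrightarrow> G \<in> gen_algebra D X \<Longrightarrow> (\<lambda>p. F p * G p) \<in> gen_algebra D X"


section \<open>Affine algebraic groups and their Lie algebras\<close>

text \<open>
  Points of affine \<open>n\<close>-space are sequences vanishing from index \<open>n\<close> on. The ground field is meant
  to be algebraically closed, so affine varieties are identified with their sets of points.
\<close>

definition affine_space :: "nat \<Rightarrow> (nat \<Rightarrow> 'k::field) set" where
  "affine_space n = {x. \<forall>i\<ge>n. x i = 0}"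

definition regular_functions :: "nat \<Rightarrow> (nat \<Rightarrow> 'k::field) set \<Rightarrow> ((nat \<Rightarrow> 'k) \<Rightarrow> 'k) set" where
  "regular_functions n V = gen_algebra V {fun_on V (\<lambda>x. x i) | i. i < n}"

definition zariski_closed :: "nat \<Rightarrow> (nat \<Rightarrow> 'k::field) set \<Rightarrow> bool" where
  "zariski_closed n V \<longleftrightarrow>
     (\<exists>Ps \<subseteq> regular_functions n (affine_space n). V = {x \<in> affine_space n. \<forall>p\<in>Ps. p x = 0})"

definition zariski_connected :: "nat \<Rightarrow> (nat \<Rightarrow> 'k::field) set \<Rightarrow> bool" where
  "zariski_connected n V \<longleftrightarrow>
     \<not> (\<exists>A B. zariski_closed n A \<and> zariski_closed n B \<and> A \<noteq> {} \<and> B \<noteq> {} \<and> A \<inter> B = {} \<and> A \<union> B = V)"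

text \<open>
  A Zariski closed subset of affine space with a group structure whose multiplication and
  inversion are morphisms of varieties, i.e. polynomial in the coordinates.
\<close>

definition affine_algebraic_group :: "nat \<Rightarrow> (nat \<Rightarrow> 'k::field) monoid \<Rightarrow> bool" where
  "affine_algebraic_group n G \<longleftrightarrow>
     group G \<and> zariski_closed n (carrier G) \<and>
     (\<forall>i<n. fun_on (carrier G \<times> carrier G) (\<lambda>(x, y). (x \<otimes>\<^bsub>G\<^esub> y) i) \<in>
        gen_algebra (carrier G \<times> carrier G)
          ({fun_on (carrier G \<times> carrier G) (\<lambda>(x, y). x j) | j. j < n} \<union>
           {fun_on (carrier G \<times> carrier G) (\<lambda>(x, y). y j) | j. j < n})) \<and>
     (\<forall>i<n. fun_on (carrier G) (\<lambda>x. (inv\<^bsub>G\<^esub> x) i) \<in> regular_functions n (carrier G))"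

definition left_translate ::
    "(nat \<Rightarrow> 'k::field) monoid \<Rightarrow> (nat \<Rightarrow> 'k) \<Rightarrow> ((nat \<Rightarrow> 'k) \<Rightarrow> 'k) \<Rightarrow> (nat \<Rightarrow> 'k) \<Rightarrow> 'k" where
  "left_translate G g F = fun_on (carrier G) (\<lambda>x. F (inv\<^bsub>G\<^esub> g \<otimes>\<^bsub>G\<^esub> x))"

text \<open>The first condition makes a derivation of the coordinate ring a unique HOL function.\<close>

definition left_invariant_derivations ::
    "nat \<Rightarrow> (nat \<Rightarrow> 'k::field) monoid \<Rightarrow> (((nat \<Rightarrow> 'k) \<Rightarrow> 'k) \<Rightarrow> (nat \<Rightarrow> 'k) \<Rightarrow> 'k) set" where
  "left_invariant_derivations n G =
     (let A = regular_functions n (carrier G) in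
      {D. (\<forall>F. F \<notin> A \<longrightarrow> D F = (\<lambda>_. 0)) \<and>
          (\<forall>F\<in>A. D F \<in> A) \<and>
          (\<forall>F\<in>A. \<forall>H\<in>A. D (\<lambda>x. F x + H x) = (\<lambda>x. D F x + D H x)) \<and>
          (\<forall>c. \<forall>F\<in>A. D (\<lambda>x. c * F x) = (\<lambda>x. c * D F x)) \<and>
          (\<forall>F\<in>A. \<forall>H\<in>A. D (\<lambda>x. F x * H x) = (\<lambda>x. F x * D H x + H x * D F x)) \<and>
          (\<forall>g\<in>carrier G. \<forall>F\<in>A. D (left_translate G g F) = left_translate G g (D F))})"

locale lie_algebra = vector_space scale
  for scale :: "'k::field \<Rightarrow> 'q::ab_group_add \<Rightarrow> 'q" +
  fixes bracket :: "'q \<Rightarrow> 'q \<Rightarrow> 'q"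
  assumes bracket_linear_right: "Vector_Spaces.linear scale scale (bracket x)"
    and bracket_linear_left: "Vector_Spaces.linear scale scale (\<lambda>x. bracket x y)"
    and bracket_self: "bracket x x = 0"
    and jacobi: "bracket x (bracket y z) + bracket y (bracket z x) + bracket z (bracket x y) = 0"

text \<open>
  The Lie algebra of \<open>G\<close> is the space of left-invariant derivations of its coordinate ring with the
  commutator as bracket; the predicate says that the given Lie algebra is isomorphic to it.
\<close>

definition is_lie_algebra_of_group ::
    "('k::field \<Rightarrow> 'q::ab_group_add \<Rightarrow> 'q) \<Rightarrow> ('q \<Rightarrow> 'q \<Rightarrow> 'q) \<Rightarrow>
     nat \<Rightarrow> (nat \<Rightarrow> 'k) monoid \<Rightarrow> bool" where
  "is_lie_algebra_of_group scale bracket n G \<longleftrightarrow>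
     (\<exists>\<Phi>. bij_betw \<Phi> UNIV (left_invariant_derivations n G) \<and>
       (\<forall>F \<in> regular_functions n (carrier G).
          (\<forall>x y. \<Phi> (x + y) F = (\<lambda>p. \<Phi> x F p + \<Phi> y F p)) \<and>
          (\<forall>c x. \<Phi> (scale c x) F = (\<lambda>p. c * \<Phi> x F p)) \<and>
          (\<forall>x y. \<Phi> (bracket x y) F = (\<lambda>p. \<Phi> x (\<Phi> y F) p - \<Phi> y (\<Phi> x F) p))))"


section \<open>The symmetric algebra as polynomial functions on the dual space\<close>

definition dual_space :: "('k::field \<Rightarrow> 'q::ab_group_add \<Rightarrow> 'q) \<Rightarrow> ('q \<Rightarrow> 'k) set" where
  "dual_space scale = {\<gamma>. Vector_Spaces.linear scale (*) \<gamma>}"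

definition ev :: "('k::field \<Rightarrow> 'q::ab_group_add \<Rightarrow> 'q) \<Rightarrow> 'q \<Rightarrow> ('q \<Rightarrow> 'k) \<Rightarrow> 'k" where
  "ev scale x = fun_on (dual_space scale) (\<lambda>\<gamma>. \<gamma> x)"

definition sym_algebra :: "('k::field \<Rightarrow> 'q::ab_group_add \<Rightarrow> 'q) \<Rightarrow> (('q \<Rightarrow> 'k) \<Rightarrow> 'k) set" where
  "sym_algebra scale = gen_algebra (dual_space scale) (range (ev scale))"

text \<open>
  \<open>has_differential scale F \<gamma> \<xi>\<close>: for every direction \<open>\<delta>\<close>, the polynomial \<open>t \<mapsto> F (\<gamma> + t \<delta>)\<close> has
  derivative \<open>\<delta> \<xi>\<close> at \<open>t = 0\<close>; here the differential, a linear form on the dual space, is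
  regarded as the element \<open>\<xi>\<close> of the Lie algebra.
\<close>

definition has_differential ::
    "('k::field \<Rightarrow> 'q::ab_group_add \<Rightarrow> 'q) \<Rightarrow> (('q \<Rightarrow> 'k) \<Rightarrow> 'k) \<Rightarrow> ('q \<Rightarrow> 'k) \<Rightarrow> 'q \<Rightarrow> bool" where
  "has_differential scale F \<gamma> \<xi> \<longleftrightarrow>
     (\<forall>\<delta> \<in> dual_space scale. \<exists>p :: 'k poly.
        (\<forall>t. F (\<lambda>x. \<gamma> x + t * \<delta> x) = poly p t) \<and> poly (pderiv p) 0 = \<delta> \<xi>)"

definition differential ::
    "('k::field \<Rightarrow> 'q::ab_group_add \<Rightarrow> 'q) \<Rightarrow> (('q \<Rightarrow> 'k) \<Rightarrow> 'k) \<Rightarrow> ('q \<Rightarrow> 'k) \<Rightarrow> 'q" where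
  "differential scale F \<gamma> = (THE \<xi>. has_differential scale F \<gamma> \<xi>)"

definition poisson_bracket_on ::
    "('p \<Rightarrow> 'k::field) set \<Rightarrow> (('p \<Rightarrow> 'k) \<Rightarrow> ('p \<Rightarrow> 'k) \<Rightarrow> 'p \<Rightarrow> 'k) \<Rightarrow> bool" where
  "poisson_bracket_on S P \<longleftrightarrow>
     (\<forall>F\<in>S. \<forall>G\<in>S. P F G \<in> S) \<and>
     (\<forall>F\<in>S. \<forall>G\<in>S. \<forall>H\<in>S. P (\<lambda>p. F p + G p) H = (\<lambda>p. P F H p + P G H p)) \<and>
     (\<forall>F\<in>S. \<forall>G\<in>S. \<forall>H\<in>S. P H (\<lambda>p. F p + G p) = (\<lambda>p. P H F p + P H G p)) \<and>
     (\<forall>c. \<forall>F\<in>S. \<forall>G\<in>S. P (\<lambda>p. c * F p) G = (\<lambda>p. c * P F G p)) \<and>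
     (\<forall>c. \<forall>F\<in>S. \<forall>G\<in>S. P F (\<lambda>p. c * G p) = (\<lambda>p. c * P F G p)) \<and>
     (\<forall>F\<in>S. P F F = (\<lambda>_. 0)) \<and>
     (\<forall>F\<in>S. \<forall>G\<in>S. \<forall>H\<in>S. P (\<lambda>p. F p * G p) H = (\<lambda>p. F p * P G H p + G p * P F H p)) \<and>
     (\<forall>F\<in>S. \<forall>G\<in>S. \<forall>H\<in>S. (\<lambda>p. P F (P G H) p + P G (P H F) p + P H (P F G) p) = (\<lambda>_. 0))"

text \<open>
  These conditions determine the values of \<open>P\<close> on the symmetric algebra; that such a \<open>P\<close> exists is
  proved below.
\<close>

definition lie_poisson_bracket ::
    "('k::field \<Rightarrow> 'q::ab_group_add \<Rightarrow> 'q) \<Rightarrow> ('q \<Rightarrow> 'q \<Rightarrow> 'q) \<Rightarrow>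
     ((('q \<Rightarrow> 'k) \<Rightarrow> 'k) \<Rightarrow> (('q \<Rightarrow> 'k) \<Rightarrow> 'k) \<Rightarrow> ('q \<Rightarrow> 'k) \<Rightarrow> 'k) \<Rightarrow> bool" where
  "lie_poisson_bracket scale bracket P \<longleftrightarrow>
     poisson_bracket_on (sym_algebra scale) P \<and>
     (\<forall>x y. P (ev scale x) (ev scale y) = ev scale (bracket x y))"

definition sym_invariants ::
    "('k::field \<Rightarrow> 'q::ab_group_add \<Rightarrow> 'q) \<Rightarrow>
     ((('q \<Rightarrow> 'k) \<Rightarrow> 'k) \<Rightarrow> (('q \<Rightarrow> 'k) \<Rightarrow> 'k) \<Rightarrow> ('q \<Rightarrow> 'k) \<Rightarrow> 'k) \<Rightarrow> (('q \<Rightarrow> 'k) \<Rightarrow> 'k) set" where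
  "sym_invariants scale P = {H \<in> sym_algebra scale. \<forall>x. P H (ev scale x) = (\<lambda>_. 0)}"

definition poisson_commutative ::
    "(('p \<Rightarrow> 'k::field) \<Rightarrow> ('p \<Rightarrow> 'k) \<Rightarrow> 'p \<Rightarrow> 'k) \<Rightarrow> ('p \<Rightarrow> 'k) set \<Rightarrow> bool" where
  "poisson_commutative P A \<longleftrightarrow> (\<forall>F\<in>A. \<forall>G\<in>A. P F G = (\<lambda>_. 0))"


section \<open>The decomposition and bi-homogeneous components\<close>

definition direct_decomposition ::
    "('k::field \<Rightarrow> 'q::ab_group_add \<Rightarrow> 'q) \<Rightarrow> 'q set \<Rightarrow> 'q set \<Rightarrow> bool" where
  "direct_decomposition scale f m \<longleftrightarrow>
     module.subspace scale f \<and> module.subspace scale m \<and> f \<inter> m = {0} \<and>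
     (\<forall>x. \<exists>a\<in>f. \<exists>b\<in>m. x = a + b)"

text \<open>The component in \<open>f\<close> of \<open>x\<close> along \<open>m\<close>; the one in \<open>m\<close> is \<open>component m f x\<close>.\<close>

definition component :: "'q set \<Rightarrow> 'q set \<Rightarrow> 'q::ab_group_add \<Rightarrow> 'q" where
  "component f m x = (THE a. a \<in> f \<and> x - a \<in> m)"

text \<open>The linear form that agrees with \<open>\<gamma>\<close> on \<open>f\<close> and vanishes on \<open>m\<close>.\<close>

definition dual_component :: "'q set \<Rightarrow> 'q set \<Rightarrow> ('q::ab_group_add \<Rightarrow> 'k) \<Rightarrow> 'q \<Rightarrow> 'k" where
  "dual_component f m \<gamma> = (\<lambda>x. \<gamma> (component f m x))"

definition phi :: "'q set \<Rightarrow> 'q set \<Rightarrow> 'k \<Rightarrow> ('q::ab_group_add \<Rightarrow> 'k::field) \<Rightarrow> 'q \<Rightarrow> 'k" where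
  "phi f m s \<gamma> = (\<lambda>x. dual_component f m \<gamma> x + s * dual_component m f \<gamma> x)"

text \<open>
  The image of \<open>S\<^sup>i(f) \<otimes> S\<^sup>j(m)\<close> under multiplication: linear combinations of products of \<open>i\<close>
  elements of \<open>f\<close> and \<open>j\<close> elements of \<open>m\<close>.
\<close>

definition bihomogeneous ::
    "('k::field \<Rightarrow> 'q::ab_group_add \<Rightarrow> 'q) \<Rightarrow> 'q set \<Rightarrow> 'q set \<Rightarrow> nat \<Rightarrow> nat \<Rightarrow> (('q \<Rightarrow> 'k) \<Rightarrow> 'k) set" where
  "bihomogeneous scale f m i j =
     {fun_on (dual_space scale)
        (\<lambda>\<gamma>. \<Sum>k<N. c k * (\<Prod>a<i. \<gamma> (x k a)) * (\<Prod>b<j. \<gamma> (y k b)))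
      | (N :: nat) c x y. \<forall>k<N. (\<forall>a<i. x k a \<in> f) \<and> (\<forall>b<j. y k b \<in> m)}"

definition bihomogeneous_decomposition ::
    "('k::field \<Rightarrow> 'q::ab_group_add \<Rightarrow> 'q) \<Rightarrow> 'q set \<Rightarrow> 'q set \<Rightarrow>
     (('q \<Rightarrow> 'k) \<Rightarrow> 'k) \<Rightarrow> (nat \<Rightarrow> nat \<Rightarrow> ('q \<Rightarrow> 'k) \<Rightarrow> 'k) \<Rightarrow> bool" where
  "bihomogeneous_decomposition scale f m H C \<longleftrightarrow>
     (\<forall>i j. C i j \<in> bihomogeneous scale f m i j) \<and>
     finite {(i, j). C i j \<noteq> (\<lambda>_. 0)} \<and>
     H = (\<lambda>\<gamma>. \<Sum>(i, j) \<in> {(i, j). C i j \<noteq> (\<lambda>_. 0)}. C i j \<gamma>)"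

definition Z_algebra ::
    "('k::field \<Rightarrow> 'q::ab_group_add \<Rightarrow> 'q) \<Rightarrow>
     ((('q \<Rightarrow> 'k) \<Rightarrow> 'k) \<Rightarrow> (('q \<Rightarrow> 'k) \<Rightarrow> 'k) \<Rightarrow> ('q \<Rightarrow> 'k) \<Rightarrow> 'k) \<Rightarrow>
     'q set \<Rightarrow> 'q set \<Rightarrow> (('q \<Rightarrow> 'k) \<Rightarrow> 'k) set" where
  "Z_algebra scale P f m =
     gen_algebra (dual_space scale)
       {C i j | H C i j. H \<in> sym_invariants scale P \<and> bihomogeneous_decomposition scale f m H C}"

section \<open>Existence and uniqueness of differentials and of the Lie--Poisson bracket\<close>

lemma fun_on_apply: "fun_on D f p = (if p \<in> D then f p else 0)"
  by (simp add: fun_on_def)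

lemma ev_apply: "ev scale x \<gamma> = (if \<gamma> \<in> dual_space scale then \<gamma> x else 0)"
  by (simp add: ev_def fun_on_def)

lemma dual_space_line:
  assumes "\<gamma> \<in> dual_space scale" "\<delta> \<in> dual_space scale"
  shows "(\<lambda>x. \<gamma> x + t * \<delta> x) \<in> dual_space scale"
  using assms unfolding dual_space_def
  by (simp add: linear_iff_module_hom module_hom_iff algebra_simps)

lemma sym_algebra_const: "fun_on (dual_space scale) (\<lambda>_. c) \<in> sym_algebra scale"
  and sym_algebra_ev: "ev scale x \<in> sym_algebra scale"
  and sym_algebra_add: "F \<in> sym_algebra scale \<Longrightarrow> G \<in> sym_algebra scale \<Longrightarrow> (\<lambda>p. F p + G p) \<in> sym_algebra scale"
  and sym_algebra_mult: "F \<in> sym_algebra scale \<Longrightarrow> G \<in> sym_algebra scale \<Longrightarrow> (\<lambda>p. F p * G p) \<in> sym_algebra scale"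
  unfolding sym_algebra_def by (auto intro: gen_algebra.intros)

lemma sym_algebra_induct [consumes 1, case_names const ev add mult]:
  assumes "F \<in> sym_algebra scale"
    and "\<And>c. Q (fun_on (dual_space scale) (\<lambda>_. c))" and "\<And>x. Q (ev scale x)"
    and "\<And>F G. F \<in> sym_algebra scale \<Longrightarrow> Q F \<Longrightarrow> G \<in> sym_algebra scale \<Longrightarrow> Q G \<Longrightarrow> Q (\<lambda>p. F p + G p)"
    and "\<And>F G. F \<in> sym_algebra scale \<Longrightarrow> Q F \<Longrightarrow> G \<in> sym_algebra scale \<Longrightarrow> Q G \<Longrightarrow> Q (\<lambda>p. F p * G p)"
  shows "Q F"
  using assms(1) unfolding sym_algebra_def
  by (induction rule: gen_algebra.induct) (use assms(2-) in \<open>auto simp: sym_algebra_def\<close>)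

lemma sym_algebra_outside:
  assumes "F \<in> sym_algebra scale" "\<gamma> \<notin> dual_space scale"
  shows "F \<gamma> = 0"
  using assms by (induction rule: sym_algebra_induct) (auto simp: fun_on_def ev_def)

lemma sym_algebra_scale:
  assumes "F \<in> sym_algebra scale"
  shows "(\<lambda>p. c * F p) \<in> sym_algebra scale"
proof -
  have "(\<lambda>p. fun_on (dual_space scale) (\<lambda>_. c) p * F p) = (\<lambda>p. c * F p)"
    using sym_algebra_outside[OF assms] by (auto simp: fun_on_def)
  then show ?thesis
    using sym_algebra_mult[OF sym_algebra_const assms, of c] by simp
qed

context vector_space
begin

lemma vector_space_field: "vector_space ((*) :: 'a \<Rightarrow> 'a \<Rightarrow> 'a)"
  by unfold_locales (simp_all add: algebra_simps)

lemma dual_space_simps: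
  assumes "\<gamma> \<in> dual_space scale"
  shows "\<gamma> (x + y) = \<gamma> x + \<gamma> y" "\<gamma> (scale c x) = c * \<gamma> x" "\<gamma> 0 = 0"
proof -
  interpret \<gamma>: Vector_Spaces.linear scale "(*)" \<gamma>
    using assms by (simp add: dual_space_def)
  show "\<gamma> (x + y) = \<gamma> x + \<gamma> y" "\<gamma> (scale c x) = c * \<gamma> x" "\<gamma> 0 = 0"
    by (simp_all add: \<gamma>.add \<gamma>.scale \<gamma>.zero)
qed

lemma dual_space_separates:
  assumes "\<And>\<gamma>. \<gamma> \<in> dual_space scale \<Longrightarrow> \<gamma> x = \<gamma> y"
  shows "x = y"
proof (rule ccontr)
  assume "x \<noteq> y"
  interpret vp: vector_space_pair scale "(*) :: 'a \<Rightarrow> 'a \<Rightarrow> 'a"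
    by (intro vector_space_pair.intro vector_space_field vector_space_axioms)
  have "independent {x - y}" using \<open>x \<noteq> y\<close> by simp
  then obtain g where g: "Vector_Spaces.linear scale (*) g" "g (x - y) = 1"
    using vp.linear_independent_extend[of "{x - y}" "\<lambda>_. 1"] by auto
  then have "g x - g y = 1"
    using vp.linear_diff by metis
  moreover have "g x = g y" using assms[of g] g by (simp add: dual_space_def)
  ultimately show False by simp
qed

end

locale lie_algebra_char_0 = lie_algebra scale bracket
  for scale :: "'k::field_char_0 \<Rightarrow> 'q::ab_group_add \<Rightarrow> 'q" and bracket
begin

abbreviation "has_diff \<equiv> has_differential scale"

lemma has_differential_unique:
  assumes "has_diff F \<gamma> \<xi>" "has_diff F \<gamma> \<eta>"
  shows "\<xi> = \<eta>"
proof (rule dual_space_separates)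
  fix \<delta> assume \<delta>: "\<delta> \<in> dual_space scale"
  obtain p where p: "\<forall>t. F (\<lambda>x. \<gamma> x + t * \<delta> x) = poly p t" "poly (pderiv p) 0 = \<delta> \<xi>"
    using assms(1) \<delta> by (auto simp: has_differential_def)
  obtain q where q: "\<forall>t. F (\<lambda>x. \<gamma> x + t * \<delta> x) = poly q t" "poly (pderiv q) 0 = \<delta> \<eta>"
    using assms(2) \<delta> by (auto simp: has_differential_def)
  have "poly p = poly q" using p q by auto
  then show "\<delta> \<xi> = \<delta> \<eta>" using p q by (simp add: poly_eq_poly_eq_iff)
qed

lemma differential_eqI: "has_diff F \<gamma> \<xi> \<Longrightarrow> differential scale F \<gamma> = \<xi>"
  unfolding differential_def using has_differential_unique by blast

lemma has_differential_const:
  assumes "\<gamma> \<in> dual_space scale"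
  shows "has_diff (fun_on (dual_space scale) (\<lambda>_. c)) \<gamma> 0"
  unfolding has_differential_def
proof
  fix \<delta> assume "\<delta> \<in> dual_space scale"
  then show "\<exists>p. (\<forall>t. fun_on (dual_space scale) (\<lambda>_. c) (\<lambda>x. \<gamma> x + t * \<delta> x) = poly p t) \<and>
      poly (pderiv p) 0 = \<delta> 0"
    using assms by (intro exI[of _ "[:c:]"]) (simp add: fun_on_def dual_space_line dual_space_simps pderiv_pCons)
qed

lemma has_differential_ev:
  assumes "\<gamma> \<in> dual_space scale"
  shows "has_diff (ev scale z) \<gamma> z"
  unfolding has_differential_def
proof
  fix \<delta> assume "\<delta> \<in> dual_space scale"
  then show "\<exists>p. (\<forall>t. ev scale z (\<lambda>x. \<gamma> x + t * \<delta> x) = poly p t) \<and> poly (pderiv p) 0 = \<delta> z"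
    using assms by (intro exI[of _ "[:\<gamma> z, \<delta> z:]"]) (simp add: ev_def fun_on_def dual_space_line pderiv_pCons)
qed

lemma has_differential_add:
  assumes "has_diff F \<gamma> \<xi>" "has_diff G \<gamma> \<eta>"
  shows "has_diff (\<lambda>p. F p + G p) \<gamma> (\<xi> + \<eta>)"
  unfolding has_differential_def
proof
  fix \<delta> assume \<delta>: "\<delta> \<in> dual_space scale"
  obtain p where "\<forall>t. F (\<lambda>x. \<gamma> x + t * \<delta> x) = poly p t" "poly (pderiv p) 0 = \<delta> \<xi>"
    using assms(1) \<delta> by (auto simp: has_differential_def)
  moreover obtain q where "\<forall>t. G (\<lambda>x. \<gamma> x + t * \<delta> x) = poly q t" "poly (pderiv q) 0 = \<delta> \<eta>"
    using assms(2) \<delta> by (auto simp: has_differential_def)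
  ultimately show "\<exists>p. (\<forall>t. F (\<lambda>x. \<gamma> x + t * \<delta> x) + G (\<lambda>x. \<gamma> x + t * \<delta> x) = poly p t) \<and>
      poly (pderiv p) 0 = \<delta> (\<xi> + \<eta>)"
    using \<delta> by (intro exI[of _ "p + q"]) (simp add: dual_space_simps pderiv_add)
qed

lemma has_differential_mult:
  assumes "has_diff F \<gamma> \<xi>" "has_diff G \<gamma> \<eta>"
  shows "has_diff (\<lambda>p. F p * G p) \<gamma> (scale (F \<gamma>) \<eta> + scale (G \<gamma>) \<xi>)"
  unfolding has_differential_def
proof
  fix \<delta> assume \<delta>: "\<delta> \<in> dual_space scale"
  obtain p where p: "\<forall>t. F (\<lambda>x. \<gamma> x + t * \<delta> x) = poly p t" "poly (pderiv p) 0 = \<delta> \<xi>"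
    using assms(1) \<delta> by (auto simp: has_differential_def)
  obtain q where q: "\<forall>t. G (\<lambda>x. \<gamma> x + t * \<delta> x) = poly q t" "poly (pderiv q) 0 = \<delta> \<eta>"
    using assms(2) \<delta> by (auto simp: has_differential_def)
  have "poly p 0 = F \<gamma>" "poly q 0 = G \<gamma>"
    using p(1)[rule_format, of 0] q(1)[rule_format, of 0] by simp_all
  then show "\<exists>p. (\<forall>t. F (\<lambda>x. \<gamma> x + t * \<delta> x) * G (\<lambda>x. \<gamma> x + t * \<delta> x) = poly p t) \<and>
      poly (pderiv p) 0 = \<delta> (scale (F \<gamma>) \<eta> + scale (G \<gamma>) \<xi>)"
    using \<delta> p q by (intro exI[of _ "p * q"]) (simp add: dual_space_simps pderiv_mult)
qed

lemma has_differential: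
  assumes "F \<in> sym_algebra scale" "\<gamma> \<in> dual_space scale"
  shows "has_diff F \<gamma> (differential scale F \<gamma>)"
proof -
  have "\<exists>\<xi>. has_diff F \<gamma> \<xi>"
    using assms
    by (induction rule: sym_algebra_induct)
      (blast intro: has_differential_const has_differential_ev has_differential_add has_differential_mult)+
  then show ?thesis using differential_eqI by auto
qed

lemma
  assumes "\<gamma> \<in> dual_space scale"
  shows differential_const: "differential scale (fun_on (dual_space scale) (\<lambda>_. c)) \<gamma> = 0"
    and differential_ev: "differential scale (ev scale x) \<gamma> = x"
    and differential_add: "F \<in> sym_algebra scale \<Longrightarrow> G \<in> sym_algebra scale \<Longrightarrow>
      differential scale (\<lambda>p. F p + G p) \<gamma> = differential scale F \<gamma> + differential scale G \<gamma>"
    and differential_mult: "F \<in> sym_algebra scale \<Longrightarrow> G \<in> sym_algebra scale \<Longrightarrow>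
      differential scale (\<lambda>p. F p * G p) \<gamma> =
        scale (F \<gamma>) (differential scale G \<gamma>) + scale (G \<gamma>) (differential scale F \<gamma>)"
  using assms
  by (auto intro!: differential_eqI has_differential_const has_differential_ev has_differential_add
      has_differential_mult has_differential)

lemma differential_scale:
  assumes "F \<in> sym_algebra scale" "\<gamma> \<in> dual_space scale"
  shows "differential scale (\<lambda>p. c * F p) \<gamma> = scale c (differential scale F \<gamma>)"
proof -
  have "(\<lambda>p. fun_on (dual_space scale) (\<lambda>_. c) p * F p) = (\<lambda>p. c * F p)"
    using sym_algebra_outside[OF assms(1)] by (auto simp: fun_on_def)
  then show ?thesis
    using differential_mult[OF assms(2) sym_algebra_const assms(1), of c] assms(2)
    by (simp add: differential_const fun_on_apply)
qed

lemma bracket_simps: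
  "bracket x (y + z) = bracket x y + bracket x z" "bracket (x + y) z = bracket x z + bracket y z"
  "bracket x (scale c y) = scale c (bracket x y)" "bracket (scale c x) y = scale c (bracket x y)"
  "bracket x 0 = 0" "bracket 0 x = 0"
proof -
  interpret r: Vector_Spaces.linear scale scale "bracket w" for w by (rule bracket_linear_right)
  interpret l: Vector_Spaces.linear scale scale "\<lambda>x. bracket x w" for w by (rule bracket_linear_left)
  show "bracket x (y + z) = bracket x y + bracket x z" "bracket x (scale c y) = scale c (bracket x y)"
    "bracket x 0 = 0"
    by (simp_all add: r.add r.scale r.zero)
  show "bracket (x + y) z = bracket x z + bracket y z" "bracket (scale c x) y = scale c (bracket x y)"
    "bracket 0 x = 0"
    by (simp_all add: l.add l.scale l.zero)
qed

lemma bracket_minus: "bracket y x = - bracket x y"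
proof -
  have "bracket (x + y) (x + y) = 0" by (rule bracket_self)
  then have "bracket x y + bracket y x = 0"
    unfolding bracket_simps by (simp add: bracket_self add.commute)
  then show ?thesis by (simp add: eq_neg_iff_add_eq_0 add.commute)
qed

definition lp :: "(('q \<Rightarrow> 'k) \<Rightarrow> 'k) \<Rightarrow> (('q \<Rightarrow> 'k) \<Rightarrow> 'k) \<Rightarrow> ('q \<Rightarrow> 'k) \<Rightarrow> 'k" where
  "lp F G = fun_on (dual_space scale)
     (\<lambda>\<gamma>. \<gamma> (bracket (differential scale F \<gamma>) (differential scale G \<gamma>)))"

lemmas lp_simps = fun_on_apply dual_space_simps differential_const differential_ev differential_add
  differential_mult differential_scale bracket_simps

lemma lp_anti: "lp F G = (\<lambda>p. (- 1) * lp G F p)"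
proof
  fix \<gamma> :: "'q \<Rightarrow> 'k"
  show "lp F G \<gamma> = (- 1) * lp G F \<gamma>"
  proof (cases "\<gamma> \<in> dual_space scale")
    case True
    have "\<gamma> (bracket x y) + \<gamma> (bracket y x) = 0" for x y
      using True by (metis dual_space_simps(1,3) bracket_minus add.right_inverse)
    then show ?thesis using True by (simp add: lp_def fun_on_def eq_neg_iff_add_eq_0)
  qed (simp add: lp_def fun_on_def)
qed

lemma lp_const: "lp (fun_on (dual_space scale) (\<lambda>_. c)) H = (\<lambda>_. 0)"
  by (rule ext) (simp add: lp_def lp_simps)

lemma lp_ev_ev: "lp (ev scale x) (ev scale y) = ev scale (bracket x y)"
  by (rule ext) (simp add: lp_def lp_simps ev_apply)

lemma
  assumes "F \<in> sym_algebra scale"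
  shows lp_add: "G \<in> sym_algebra scale \<Longrightarrow> lp (\<lambda>p. F p + G p) H = (\<lambda>p. lp F H p + lp G H p)"
    and lp_add_right: "G \<in> sym_algebra scale \<Longrightarrow> lp H (\<lambda>p. F p + G p) = (\<lambda>p. lp H F p + lp H G p)"
    and lp_scale: "lp (\<lambda>p. c * F p) H = (\<lambda>p. c * lp F H p)"
    and lp_scale_right: "lp H (\<lambda>p. c * F p) = (\<lambda>p. c * lp H F p)"
    and lp_mult: "G \<in> sym_algebra scale \<Longrightarrow>
      lp (\<lambda>p. F p * G p) H = (\<lambda>p. F p * lp G H p + G p * lp F H p)"
    and lp_mult_right: "G \<in> sym_algebra scale \<Longrightarrow>
      lp H (\<lambda>p. F p * G p) = (\<lambda>p. F p * lp H G p + G p * lp H F p)"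
  using assms by (auto simp: fun_eq_iff lp_def lp_simps)

lemma lp_self: "lp F F = (\<lambda>_. 0)"
  by (auto simp: fun_eq_iff lp_def fun_on_def bracket_self dual_space_simps)

lemma zero_in_sym_algebra: "(\<lambda>_. 0) \<in> sym_algebra scale"
proof -
  have "fun_on (dual_space scale) (\<lambda>_. 0 :: 'k) = (\<lambda>_. 0)" by (auto simp: fun_on_def)
  then show ?thesis using sym_algebra_const[of scale 0] by simp
qed

lemma lp_closed:
  assumes "F \<in> sym_algebra scale" "H \<in> sym_algebra scale"
  shows "lp F H \<in> sym_algebra scale"
proof -
  have ev: "lp (ev scale x) H \<in> sym_algebra scale" for x
    using assms(2)
  proof (induction rule: sym_algebra_induct)
    case (const c)
    then show ?case
      using lp_anti[of "ev scale x" "fun_on (dual_space scale) (\<lambda>_. c)"] by (simp add: lp_const zero_in_sym_algebra)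
  qed (simp_all add: lp_ev_ev lp_add_right lp_mult_right sym_algebra_ev sym_algebra_add sym_algebra_mult)
  show ?thesis
    using assms(1)
    by (induction rule: sym_algebra_induct)
      (simp_all add: ev lp_const zero_in_sym_algebra lp_add lp_mult sym_algebra_add sym_algebra_mult)
qed

definition jac where
  "jac F G H p = lp F (lp G H) p + lp G (lp H F) p + lp H (lp F G) p"

lemma jac_rot: "jac F G H = jac G H F"
  by (auto simp: fun_eq_iff jac_def)

lemma lp_zero_right: "lp F (\<lambda>_. 0) = (\<lambda>_. 0)"
  using lp_scale_right[OF zero_in_sym_algebra, of F 0] by simp

lemma lp_const_right: "lp H (fun_on (dual_space scale) (\<lambda>_. c)) = (\<lambda>_. 0)"
  by (subst lp_anti) (simp add: lp_const)

lemma jac_reduce: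
  assumes "F \<in> sym_algebra scale" "G \<in> sym_algebra scale" "H \<in> sym_algebra scale"
    and "\<And>x. jac (ev scale x) G H = (\<lambda>_. 0)"
  shows "jac F G H = (\<lambda>_. 0)"
  using assms(1)
proof (induction rule: sym_algebra_induct)
  case (const c)
  show ?case by (auto simp: fun_eq_iff jac_def lp_const lp_const_right lp_zero_right)
next
  case (ev x)
  show ?case by (rule assms)
next
  case (add F1 F2)
  have "jac (\<lambda>p. F1 p + F2 p) G H p = jac F1 G H p + jac F2 G H p" for p
    using add assms by (simp add: jac_def lp_add lp_add_right lp_closed)
  then show ?case using add by (simp add: fun_eq_iff)
next
  case (mult F1 F2)
  have "jac (\<lambda>p. F1 p * F2 p) G H p = F1 p * jac F2 G H p + F2 p * jac F1 G H p" for p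
  proof -
    have a: "lp G F1 p = - lp F1 G p" "lp G F2 p = - lp F2 G p"
      "lp H F1 p = - lp F1 H p" "lp H F2 p = - lp F2 H p"
      by (subst lp_anti, simp)+
    show ?thesis
      using mult assms
      by (simp add: jac_def lp_add lp_add_right lp_mult lp_mult_right lp_closed sym_algebra_mult)
        (simp add: a algebra_simps)
  qed
  then show ?case using mult by (simp add: fun_eq_iff)
qed

lemma jac_ev: "jac (ev scale x) (ev scale y) (ev scale z) = (\<lambda>_. 0)"
proof
  fix \<gamma> :: "'q \<Rightarrow> 'k"
  show "jac (ev scale x) (ev scale y) (ev scale z) \<gamma> = 0"
    using jacobi[of x y z] dual_space_simps(1,3)[of \<gamma>]
    by (simp add: jac_def lp_ev_ev ev_apply) metis
qed

lemma jac_zero: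
  assumes "F \<in> sym_algebra scale" "G \<in> sym_algebra scale" "H \<in> sym_algebra scale"
  shows "jac F G H = (\<lambda>_. 0)"
proof -
  have 1: "jac F (ev scale y) (ev scale z) = (\<lambda>_. 0)" if "F \<in> sym_algebra scale" for F y z
    by (rule jac_reduce) (simp_all add: that sym_algebra_ev jac_ev)
  have 2: "jac F G (ev scale z) = (\<lambda>_. 0)" if "F \<in> sym_algebra scale" "G \<in> sym_algebra scale" for F G z
  proof (rule jac_reduce)
    show "jac (ev scale x) G (ev scale z) = (\<lambda>_. 0)" for x
      unfolding jac_rot[of "ev scale x"] using that(2) by (rule 1)
  qed (simp_all add: that sym_algebra_ev)
  show ?thesis
  proof (rule jac_reduce)
    show "jac (ev scale x) G H = (\<lambda>_. 0)" for x
      unfolding jac_rot[of "ev scale x"] using assms(2,3) by (rule 2)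
  qed (simp_all add: assms)
qed

theorem lie_poisson_bracket_exists: "lie_poisson_bracket scale bracket lp"
  unfolding lie_poisson_bracket_def poisson_bracket_on_def
  by (simp add: lp_ev_ev lp_closed lp_add lp_add_right lp_scale lp_scale_right lp_self lp_mult
      jac_zero flip: jac_def)

theorem lie_poisson_bracket_unique:
  assumes "lie_poisson_bracket scale bracket P"
    and "F \<in> sym_algebra scale" "G \<in> sym_algebra scale"
  shows "P F G = lp F G"
proof -
  let ?S = "sym_algebra scale" and ?one = "fun_on (dual_space scale) (\<lambda>_. 1 :: 'k)"
  have add: "P (\<lambda>p. F p + G p) H = (\<lambda>p. P F H p + P G H p)"
    and addr: "P H (\<lambda>p. F p + G p) = (\<lambda>p. P H F p + P H G p)"
    and mult: "P (\<lambda>p. F p * G p) H = (\<lambda>p. F p * P G H p + G p * P F H p)"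
    and scale: "P (\<lambda>p. c * F p) H = (\<lambda>p. c * P F H p)"
    and self: "P F F = (\<lambda>_. 0)"
    and closed: "P F G \<in> ?S"
    and ev: "P (ev scale x) (ev scale y) = ev scale (bracket x y)"
    if "F \<in> ?S" "G \<in> ?S" "H \<in> ?S" for F G H c x y
    using assms(1) that unfolding lie_poisson_bracket_def poisson_bracket_on_def by simp_all
  have anti: "P F G = (\<lambda>p. (- 1) * P G F p)" if S: "F \<in> ?S" "G \<in> ?S" for F G
  proof
    fix p
    have "P (\<lambda>p. F p + G p) (\<lambda>p. F p + G p) p = 0"
      using S by (simp add: self sym_algebra_add)
    then have "P F G p + P G F p = 0"
      using S by (simp add: add addr sym_algebra_add self)
    then show "P F G p = (- 1) * P G F p" by (simp add: eq_neg_iff_add_eq_0)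
  qed
  have const: "P (fun_on (dual_space scale) (\<lambda>_. c)) H = (\<lambda>_. 0)" if S: "H \<in> ?S" for H c
  proof -
    have "(\<lambda>p. ?one p * ?one p) = ?one" by (auto simp: fun_on_def)
    then have eq: "P ?one H = (\<lambda>p. ?one p * P ?one H p + ?one p * P ?one H p)"
      using mult[of ?one ?one H] S by (simp add: sym_algebra_const)
    have one: "P ?one H p = 0" for p
    proof (cases "p \<in> dual_space scale")
      case True
      then show ?thesis using fun_cong[OF eq, of p] by (simp add: fun_on_def)
    next
      case False
      then show ?thesis
        using closed[of ?one H] S sym_algebra_outside by (metis sym_algebra_const)
    qed
    have "fun_on (dual_space scale) (\<lambda>_. c) = (\<lambda>p. c * ?one p)" by (auto simp: fun_on_def)
    then show ?thesis using scale[of ?one ?one H c] S one by (simp add: sym_algebra_const)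
  qed
  have ev_case: "P (ev scale x) H = lp (ev scale x) H" if "H \<in> ?S" for H x
  proof -
    have "P H (ev scale x) = lp H (ev scale x)"
      using that
    proof (induction rule: sym_algebra_induct)
      case (ev y)
      show ?case using assms(1) by (simp add: lie_poisson_bracket_def lp_ev_ev)
    qed (simp_all add: const lp_const add mult lp_add lp_mult sym_algebra_ev)
    then show ?thesis
      using anti[of "ev scale x" H] lp_anti[of "ev scale x" H] that by (simp add: sym_algebra_ev)
  qed
  show ?thesis
    using assms(2)
    by (induction rule: sym_algebra_induct)
      (use assms(3) in \<open>simp_all add: ev_case const lp_const add mult lp_add lp_mult\<close>)
qed

end

end

theory Submission
  imports Defs
begin

text \<open>
  Put \<open>\<xi> = d H\<close> at \<open>\<phi>\<^sub>s \<gamma>\<close> and \<open>\<eta> = d H'\<close> at \<open>\<phi>\<^sub>t \<gamma>\<close> for invariants \<open>H\<close>, \<open>H'\<close>, and let \<open>A\<close> be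
  the value of \<open>\<gamma>\<close> on \<open>[\<xi>\<^sub>f, \<eta>\<^sub>f]\<close>. Invariance of \<open>H\<close>, tested on \<open>\<eta>\<^sub>f\<close> and \<open>\<eta>\<^sub>m\<close>, and of \<open>H'\<close>, tested on
  \<open>\<xi>\<^sub>f\<close> and \<open>\<xi>\<^sub>m\<close>, gives four linear relations which for \<open>s \<noteq> t\<close> force the bracket of \<open>H \<circ> \<phi>\<^sub>s\<close> and
  \<open>H' \<circ> \<phi>\<^sub>t\<close> at \<open>\<gamma>\<close> to be \<open>- (1 - s) (1 - t) A\<close>. As \<open>A\<close> is polynomial in \<open>s\<close> and in \<open>t\<close>, it vanishes
  identically as soon as all these brackets do. Conversely, \<open>\<gamma> \<mapsto> H (r \<gamma>)\<close> is invariant along with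
  \<open>H\<close>, so the brackets of all \<open>H (r \<gamma>\<^sub>f + s \<gamma>\<^sub>m)\<close> vanish for \<open>r\<close>, \<open>s\<close> generic when \<open>A\<close> does; the
  bi-homogeneous components are the coefficients of these functions at the monomials in \<open>r\<close> and \<open>s\<close>.
\<close>

section \<open>Polynomials in one and two scalars\<close>

lemma poly_zero_cofinite:
  fixes p :: "'k::field_char_0 poly"
  assumes "finite B" "\<And>t. t \<notin> B \<Longrightarrow> poly p t = 0"
  shows "p = 0"
proof (rule ccontr)
  assume "p \<noteq> 0"
  then have "finite {t. poly p t = 0}" by (rule poly_roots_finite)
  then have "finite (B \<union> {t. poly p t = 0})" using assms(1) by simp
  moreover have "B \<union> {t. poly p t = 0} = UNIV" using assms(2) by auto
  ultimately show False by (simp add: infinite_UNIV_char_0)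
qed

text \<open>The sum is the value at \<open>t\<close> of a polynomial with infinitely many zeros.
  Several indices may share an exponent, so a coefficient is a sum over a fibre of
  \<open>e\<close>.\<close>

lemma power_sum_coeff_zero:
  fixes c :: "'i \<Rightarrow> 'k::field_char_0"
  assumes "finite S" "finite B" "\<And>t. t \<notin> B \<Longrightarrow> (\<Sum>q\<in>S. t ^ e q * c q) = 0"
  shows "(\<Sum>q\<in>{q\<in>S. e q = n}. c q) = 0"
proof -
  let ?p = "\<Sum>q\<in>S. monom (c q) (e q)"
  have "?p = 0"
    using assms(2)
  proof (rule poly_zero_cofinite)
    show "poly ?p t = 0" if "t \<notin> B" for t
      using assms(3)[OF that] by (simp add: poly_sum poly_monom mult.commute)
  qed
  then have "coeff ?p n = 0" by simp
  then show ?thesis by (simp add: coeff_sum sum.inter_filter[OF assms(1)])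
qed

text \<open>Coefficients are compared in \<open>s\<close> for each fixed \<open>r\<close>, then in
  \<open>r\<close>. The exceptional set depends on \<open>r\<close> because in the application the
  excluded values of \<open>s\<close> do.\<close>

lemma power_sum2_coeff_zero:
  fixes c :: "nat \<Rightarrow> nat \<Rightarrow> 'k::field_char_0"
  assumes S: "finite S" and B: "\<And>r. finite (B r)"
    and zero: "\<And>r s. r \<noteq> 0 \<Longrightarrow> s \<notin> B r \<Longrightarrow> (\<Sum>(i, j)\<in>S. r ^ i * s ^ j * c i j) = 0"
    and "(i, j) \<in> S"
  shows "c i j = 0"
proof -
  have 1: "(\<Sum>q\<in>{q\<in>S. snd q = j}. r ^ fst q * c (fst q) (snd q)) = 0" if "r \<noteq> 0" for r
  proof (rule power_sum_coeff_zero[OF S B])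
    show "(\<Sum>q\<in>S. s ^ snd q * (r ^ fst q * c (fst q) (snd q))) = 0" if "s \<notin> B r" for s
      using zero[OF \<open>r \<noteq> 0\<close> that] by (simp add: case_prod_beta mult_ac)
  qed
  have "(\<Sum>q\<in>{q\<in>{q\<in>S. snd q = j}. fst q = i}. c (fst q) (snd q)) = 0"
    by (rule power_sum_coeff_zero[where B = "{0}"]) (use S 1 in auto)
  moreover have "{q\<in>{q\<in>S. snd q = j}. fst q = i} = {(i, j)}" using \<open>(i, j) \<in> S\<close> by auto
  ultimately show ?thesis by simp
qed


section \<open>Components with respect to a direct decomposition\<close>

context vector_space
begin

lemma direct_decomposition_commute:
  "direct_decomposition scale f m \<longleftrightarrow> direct_decomposition scale m f"
  unfolding direct_decomposition_def by (metis add.commute inf_commute)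

lemma component_eqI:
  assumes "direct_decomposition scale f m" "a \<in> f" "x - a \<in> m"
  shows "component f m x = a"
  unfolding component_def
proof (rule the_equality)
  fix b assume b: "b \<in> f \<and> x - b \<in> m"
  have "subspace f" "subspace m" using assms(1) by (simp_all add: direct_decomposition_def)
  then have "b - a \<in> f" "(x - a) - (x - b) \<in> m"
    using assms b by (blast intro: subspace_diff)+
  then have "b - a \<in> f \<inter> m" by simp
  also have "f \<inter> m = {0}" using assms(1) by (simp add: direct_decomposition_def)
  finally show "b = a" by simp
qed (use assms in auto)

context
  fixes f m :: "'b set"
  assumes dec: "direct_decomposition scale f m"
begin

lemma component_mem: "component f m x \<in> f" "x - component f m x \<in> m"
proof -
  obtain a b where ab: "a \<in> f" "b \<in> m" "x = a + b"
    using dec unfolding direct_decomposition_def by blast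
  then have "component f m x = a" using dec by (intro component_eqI) auto
  then show "component f m x \<in> f" "x - component f m x \<in> m" using ab by auto
qed

lemma component_complement: "component m f x = x - component f m x"
  using dec component_mem[of x]
  by (intro component_eqI) (simp_all add: direct_decomposition_commute[of m f])

lemma component_sum: "component f m x + component m f x = x"
  by (simp add: component_complement)

lemma component_id: "x \<in> f \<Longrightarrow> component f m x = x"
  using dec by (intro component_eqI) (auto simp: direct_decomposition_def subspace_0)

lemma component_zero: "x \<in> m \<Longrightarrow> component f m x = 0"
  using dec by (intro component_eqI) (auto simp: direct_decomposition_def subspace_0)

lemma component_add: "component f m (x + y) = component f m x + component f m y"
proof (rule component_eqI[OF dec])
  have "(x - component f m x) + (y - component f m y) \<in> m"
    using dec component_mem by (auto simp: direct_decomposition_def intro: subspace_add)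
  then show "x + y - (component f m x + component f m y) \<in> m" by (simp add: algebra_simps)
qed (use dec component_mem in \<open>auto simp: direct_decomposition_def intro: subspace_add\<close>)

lemma component_scale: "component f m (scale c x) = scale c (component f m x)"
proof (rule component_eqI[OF dec])
  have "scale c (x - component f m x) \<in> m"
    using dec component_mem by (auto simp: direct_decomposition_def intro: subspace_scale)
  then show "scale c x - scale c (component f m x) \<in> m" by (simp add: algebra_simps)
qed (use dec component_mem in \<open>auto simp: direct_decomposition_def intro: subspace_scale\<close>)

end

lemma dual_spaceI:
  assumes "\<And>x y. \<gamma> (x + y) = \<gamma> x + \<gamma> y" "\<And>c x. \<gamma> (scale c x) = c * \<gamma> x"
  shows "\<gamma> \<in> dual_space scale"
  unfolding dual_space_def
  by (intro CollectI Vector_Spaces.linear.intro module_hom.intro module_hom_axioms.intro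
      vector_space_axioms vector_space_field module_axioms
      vector_space_field[folded module_iff_vector_space] assms)

lemma dual_component_mem:
  assumes "direct_decomposition scale f m" "\<gamma> \<in> dual_space scale"
  shows "dual_component f m \<gamma> \<in> dual_space scale"
  by (rule dual_spaceI)
    (simp_all add: dual_component_def component_add[OF assms(1)] component_scale[OF assms(1)]
      dual_space_simps[OF assms(2)])

end


section \<open>Pulling back along a linear map\<close>

text \<open>For linear \<open>L\<close> this is the algebra endomorphism of the symmetric algebra
  that extends \<open>L\<close>: it sends \<open>ev scale x\<close> to
  \<open>ev scale (L x)\<close>.\<close>

definition pullback ::
    "('k::field \<Rightarrow> 'q::ab_group_add \<Rightarrow> 'q) \<Rightarrow> ('q \<Rightarrow> 'q) \<Rightarrow> (('q \<Rightarrow> 'k) \<Rightarrow> 'k) \<Rightarrow> ('q \<Rightarrow> 'k) \<Rightarrow> 'k" where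
  "pullback scale L F = fun_on (dual_space scale) (\<lambda>\<gamma>. F (\<gamma> \<circ> L))"

context lie_algebra_char_0
begin

context
  fixes L :: "'q \<Rightarrow> 'q"
  assumes L_add: "\<And>x y. L (x + y) = L x + L y" and L_scale: "\<And>c x. L (scale c x) = scale c (L x)"
begin

lemma dual_space_comp: "\<gamma> \<in> dual_space scale \<Longrightarrow> \<gamma> \<circ> L \<in> dual_space scale"
  by (intro dual_spaceI) (simp_all add: L_add L_scale dual_space_simps)

lemma pullback_closed:
  assumes "F \<in> sym_algebra scale"
  shows "pullback scale L F \<in> sym_algebra scale"
  using assms
proof (induction rule: sym_algebra_induct)
  case (const c)
  have "pullback scale L (fun_on (dual_space scale) (\<lambda>_. c)) = fun_on (dual_space scale) (\<lambda>_. c)"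
    by (auto simp: pullback_def fun_on_def dual_space_comp)
  then show ?case by (simp add: sym_algebra_const)
next
  case (ev x)
  have "pullback scale L (ev scale x) = ev scale (L x)"
    by (auto simp: pullback_def fun_on_def ev_apply dual_space_comp)
  then show ?case by (simp add: sym_algebra_ev)
next
  case (add F G)
  have "pullback scale L (\<lambda>p. F p + G p) = (\<lambda>p. pullback scale L F p + pullback scale L G p)"
    by (auto simp: pullback_def fun_on_def)
  then show ?case using add by (simp add: sym_algebra_add)
next
  case (mult F G)
  have "pullback scale L (\<lambda>p. F p * G p) = (\<lambda>p. pullback scale L F p * pullback scale L G p)"
    by (auto simp: pullback_def fun_on_def)
  then show ?case using mult by (simp add: sym_algebra_mult)
qed

text \<open>Chain rule: composition with \<open>L\<close> carries the line \<gamma> + t \<delta> to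
  a line with direction \<open>\<delta> \<circ> L\<close>, so the polynomial found for
  \<open>F\<close> there also serves the pullback.\<close>

lemma differential_pullback:
  assumes "F \<in> sym_algebra scale" "\<gamma> \<in> dual_space scale"
  shows "differential scale (pullback scale L F) \<gamma> = L (differential scale F (\<gamma> \<circ> L))"
proof (rule differential_eqI)
  show "has_diff (pullback scale L F) \<gamma> (L (differential scale F (\<gamma> \<circ> L)))"
    unfolding has_differential_def
  proof
    fix \<delta> assume \<delta>: "\<delta> \<in> dual_space scale"
    obtain p where "\<forall>t. F (\<lambda>x. (\<gamma> \<circ> L) x + t * (\<delta> \<circ> L) x) = poly p t"
      "poly (pderiv p) 0 = (\<delta> \<circ> L) (differential scale F (\<gamma> \<circ> L))"
      using has_differential[OF assms(1) dual_space_comp[OF assms(2)]] dual_space_comp[OF \<delta>]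
      unfolding has_differential_def by blast
    then show "\<exists>p. (\<forall>t. pullback scale L F (\<lambda>x. \<gamma> x + t * \<delta> x) = poly p t) \<and>
        poly (pderiv p) 0 = \<delta> (L (differential scale F (\<gamma> \<circ> L)))"
      using dual_space_line[OF assms(2) \<delta>]
      by (intro exI[of _ p]) (simp add: pullback_def fun_on_def comp_def)
  qed
qed

end

text \<open>In the product rule the differentials are multiplied by values of the factors, and these
  are polynomial along the line by \<open>has_differential\<close>.\<close>

lemma differential_along_line:
  assumes "F \<in> sym_algebra scale" "\<gamma> \<in> dual_space scale" "\<delta> \<in> dual_space scale"
    "l \<in> dual_space scale"
  shows "\<exists>p. \<forall>t. l (differential scale F (\<lambda>x. \<gamma> x + t * \<delta> x)) = poly p t"
  using assms(1)
proof (induction rule: sym_algebra_induct)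
  case (const c)
  show ?case
    using assms by (intro exI[of _ 0]) (simp add: differential_const dual_space_line dual_space_simps)
next
  case (ev x)
  show ?case
    using assms by (intro exI[of _ "[:l x:]"]) (simp add: differential_ev dual_space_line)
next
  case (add F G)
  obtain p q where "\<forall>t. l (differential scale F (\<lambda>x. \<gamma> x + t * \<delta> x)) = poly p t"
    "\<forall>t. l (differential scale G (\<lambda>x. \<gamma> x + t * \<delta> x)) = poly q t"
    using add.IH by blast
  then show ?case
    using assms add.hyps
    by (intro exI[of _ "p + q"]) (simp add: differential_add dual_space_line dual_space_simps)
next
  case (mult F G)
  obtain p q where "\<forall>t. l (differential scale F (\<lambda>x. \<gamma> x + t * \<delta> x)) = poly p t"
    "\<forall>t. l (differential scale G (\<lambda>x. \<gamma> x + t * \<delta> x)) = poly q t"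
    using mult.IH by blast
  moreover obtain p' q' where "\<forall>t. F (\<lambda>x. \<gamma> x + t * \<delta> x) = poly p' t"
    "\<forall>t. G (\<lambda>x. \<gamma> x + t * \<delta> x) = poly q' t"
    using has_differential[OF mult.hyps(1) assms(2)] has_differential[OF mult.hyps(2) assms(2)] assms(3)
    unfolding has_differential_def by meson
  ultimately show ?case
    using assms mult.hyps
    by (intro exI[of _ "p' * q + q' * p"])
      (simp add: differential_mult dual_space_line dual_space_simps)
qed


section \<open>Linear combinations and generated algebras\<close>

lemma sym_algebra_sum:
  assumes "finite S" "\<And>q. q \<in> S \<Longrightarrow> F q \<in> sym_algebra scale"
  shows "(\<lambda>\<gamma>. \<Sum>q\<in>S. c q * F q \<gamma>) \<in> sym_algebra scale"
  using assms
  by (induction S) (simp_all add: zero_in_sym_algebra sym_algebra_add sym_algebra_scale)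

lemma lp_sum:
  assumes "finite S" "\<And>q. q \<in> S \<Longrightarrow> F q \<in> sym_algebra scale"
  shows "lp (\<lambda>\<gamma>. \<Sum>q\<in>S. c q * F q \<gamma>) H = (\<lambda>\<gamma>. \<Sum>q\<in>S. c q * lp (F q) H \<gamma>)"
  using assms
proof (induction S)
  case empty
  then show ?case using lp_scale[OF zero_in_sym_algebra, of 0 H] by simp
next
  case (insert q S)
  then show ?case
    by (simp add: lp_add lp_scale sym_algebra_sum sym_algebra_scale)
qed

lemma lp_sum_right:
  assumes "finite S" "\<And>q. q \<in> S \<Longrightarrow> F q \<in> sym_algebra scale"
  shows "lp H (\<lambda>\<gamma>. \<Sum>q\<in>S. c q * F q \<gamma>) = (\<lambda>\<gamma>. \<Sum>q\<in>S. c q * lp H (F q) \<gamma>)"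
  using assms
proof (induction S)
  case empty
  then show ?case by (simp add: lp_zero_right)
next
  case (insert q S)
  then show ?case
    by (simp add: lp_add_right lp_scale_right sym_algebra_sum sym_algebra_scale)
qed

context
  fixes X :: "(('q \<Rightarrow> 'k) \<Rightarrow> 'k) set"
  assumes X: "X \<subseteq> sym_algebra scale"
begin

lemma gen_algebra_subset: "gen_algebra (dual_space scale) X \<subseteq> sym_algebra scale"
proof
  fix F assume "F \<in> gen_algebra (dual_space scale) X"
  then show "F \<in> sym_algebra scale"
    by induction (use X in \<open>auto intro: sym_algebra_const sym_algebra_add sym_algebra_mult\<close>)
qed

lemma gen_algebra_sum:
  assumes "finite S" "\<And>q. q \<in> S \<Longrightarrow> F q \<in> X"
  shows "(\<lambda>\<gamma>. \<Sum>q\<in>S. c q * F q \<gamma>) \<in> gen_algebra (dual_space scale) X"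
  using assms
proof (induction S)
  case empty
  have "fun_on (dual_space scale) (\<lambda>_. 0 :: 'k) = (\<lambda>_. 0)" by (auto simp: fun_on_def)
  then show ?case using gen_algebra.const[of "dual_space scale" "0 :: 'k" X] by simp
next
  case (insert q S)
  \<comment> \<open>The constants of the algebra are cut off outside the dual space; this is
    harmless since \<open>F q\<close> vanishes there.\<close>
  have "(\<lambda>\<gamma>. fun_on (dual_space scale) (\<lambda>_. c q) \<gamma> * F q \<gamma>) = (\<lambda>\<gamma>. c q * F q \<gamma>)"
    using insert.prems X sym_algebra_outside by (fastforce simp: fun_on_def)
  moreover have "(\<lambda>\<gamma>. fun_on (dual_space scale) (\<lambda>_. c q) \<gamma> * F q \<gamma>) \<in> gen_algebra (dual_space scale) X"
    using insert.prems by (intro gen_algebra.mult gen_algebra.const gen_algebra.gen) simp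
  ultimately show ?case using insert by (simp add: gen_algebra.add)
qed

text \<open>By the Leibniz rule the elements commuting with a fixed one form a subalgebra. This is
  used on the right with a generator on the left, then on the left.\<close>

lemma gen_algebra_lp_zero:
  assumes zero: "\<And>F G. F \<in> X \<Longrightarrow> G \<in> X \<Longrightarrow> lp F G = (\<lambda>_. 0)"
    and F: "F \<in> gen_algebra (dual_space scale) X" and G: "G \<in> gen_algebra (dual_space scale) X"
  shows "lp F G = (\<lambda>_. 0)"
proof -
  note sub = gen_algebra_subset[THEN subsetD]
  have 1: "lp F G = (\<lambda>_. 0)" if "F \<in> X" for F
    using G
  proof induction
    case (gen G)
    then show ?case using zero that by simp
  qed (simp_all add: lp_const_right lp_add_right lp_mult_right sub)
  from F show ?thesis
    by induction (simp_all add: lp_const lp_add lp_mult sub 1)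
qed

end

end


section \<open>Bi-homogeneous elements\<close>

locale decomposed_lie_algebra = lie_algebra_char_0 scale bracket
  for scale :: "'k::field_char_0 \<Rightarrow> 'q::ab_group_add \<Rightarrow> 'q" and bracket +
  fixes f m :: "'q set"
  assumes decomposition: "direct_decomposition scale f m"
    and f_closed: "x \<in> f \<Longrightarrow> y \<in> f \<Longrightarrow> bracket x y \<in> f"
    and f_acts: "x \<in> f \<Longrightarrow> y \<in> m \<Longrightarrow> bracket x y \<in> m"
begin

abbreviation "cf \<equiv> component f m"
abbreviation "cm \<equiv> component m f"
abbreviation "bihom \<equiv> bihomogeneous scale f m"

lemma decomposition': "direct_decomposition scale m f"
  using decomposition direct_decomposition_commute by blast

lemmas component_simps =
  component_add[OF decomposition] component_scale[OF decomposition]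
  component_add[OF decomposition'] component_scale[OF decomposition']
  component_id[OF decomposition] component_zero[OF decomposition]
  component_id[OF decomposition'] component_zero[OF decomposition']

lemmas component_in = component_mem(1)[OF decomposition] component_mem(1)[OF decomposition']

lemma bihomI:
  assumes "\<And>k a. k < N \<Longrightarrow> a < i \<Longrightarrow> x k a \<in> f" "\<And>k b. k < N \<Longrightarrow> b < j \<Longrightarrow> y k b \<in> m"
    and "\<And>\<gamma>. \<gamma> \<in> dual_space scale \<Longrightarrow>
      F \<gamma> = (\<Sum>k<(N::nat). c k * (\<Prod>a<i. \<gamma> (x k a)) * (\<Prod>b<j. \<gamma> (y k b)))"
    and "\<And>\<gamma>. \<gamma> \<notin> dual_space scale \<Longrightarrow> F \<gamma> = 0"
  shows "F \<in> bihom i j"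
  unfolding bihomogeneous_def
  using assms by (intro CollectI exI[of _ N] exI[of _ c] exI[of _ x] exI[of _ y]) (auto simp: fun_on_def)

lemma bihomE:
  assumes "F \<in> bihom i j"
  obtains N c x y where "\<And>k a. k < N \<Longrightarrow> a < i \<Longrightarrow> x k a \<in> f"
    "\<And>k b. k < N \<Longrightarrow> b < j \<Longrightarrow> y k b \<in> m"
    "F = fun_on (dual_space scale)
      (\<lambda>\<gamma>. \<Sum>k<(N::nat). c k * (\<Prod>a<i. \<gamma> (x k a)) * (\<Prod>b<j. \<gamma> (y k b)))"
proof -
  obtain N c x y where "F = fun_on (dual_space scale)
      (\<lambda>\<gamma>. \<Sum>k<(N::nat). c k * (\<Prod>a<i. \<gamma> (x k a)) * (\<Prod>b<j. \<gamma> (y k b)))"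
    "\<forall>k<N. (\<forall>a<i. x k a \<in> f) \<and> (\<forall>b<j. y k b \<in> m)"
    using assms unfolding bihomogeneous_def by blast
  then show thesis using that[of N x y c] by blast
qed

section \<open>Closure of bi-homogeneous elements under sums and products\<close>

lemma bihom_zero: "(\<lambda>_. 0) \<in> bihom i j"
  by (rule bihomI[where N = 0]) auto

lemma bihom_add:
  assumes "F \<in> bihom i j" "G \<in> bihom i j"
  shows "(\<lambda>\<gamma>. F \<gamma> + G \<gamma>) \<in> bihom i j"
proof -
  obtain N c x y where F: "\<And>k a. k < N \<Longrightarrow> a < i \<Longrightarrow> x k a \<in> f"
    "\<And>k b. k < N \<Longrightarrow> b < j \<Longrightarrow> y k b \<in> m"
    "F = fun_on (dual_space scale)
      (\<lambda>\<gamma>. \<Sum>k<(N::nat). c k * (\<Prod>a<i. \<gamma> (x k a)) * (\<Prod>b<j. \<gamma> (y k b)))"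
    using assms(1) by (rule bihomE) blast
  obtain M d u v where G: "\<And>k a. k < M \<Longrightarrow> a < i \<Longrightarrow> u k a \<in> f"
    "\<And>k b. k < M \<Longrightarrow> b < j \<Longrightarrow> v k b \<in> m"
    "G = fun_on (dual_space scale)
      (\<lambda>\<gamma>. \<Sum>k<(M::nat). d k * (\<Prod>a<i. \<gamma> (u k a)) * (\<Prod>b<j. \<gamma> (v k b)))"
    using assms(2) by (rule bihomE) blast
  have split: "(\<Sum>k<N + M. h k) = (\<Sum>k<N. h k) + (\<Sum>k<M. h (N + k))" for h :: "nat \<Rightarrow> 'k"
    by (induction M) (simp_all add: add_ac)
  \<comment> \<open>The two lists of terms are concatenated: indices from \<open>N\<close> on are
    shifted back and refer to \<open>G\<close>.\<close>
  show ?thesis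
    by (rule bihomI[where N = "N + M" and c = "\<lambda>k. if k < N then c k else d (k - N)"
          and x = "\<lambda>k. if k < N then x k else u (k - N)"
          and y = "\<lambda>k. if k < N then y k else v (k - N)"])
      (use F(1,2) G(1,2) in \<open>auto simp: F(3) G(3) fun_on_def split\<close>)
qed

lemma bihom_sum:
  assumes "finite S" "\<And>q. q \<in> S \<Longrightarrow> F q \<in> bihom i j"
  shows "(\<lambda>\<gamma>. \<Sum>q\<in>S. F q \<gamma>) \<in> bihom i j"
  using assms by (induction S) (simp_all add: bihom_zero bihom_add)

text \<open>A product of two terms is again a single term, with the lists of linear factors
  concatenated; \<open>bihom_sum\<close> then handles the double sum.\<close>

lemma bihom_mult:
  assumes "F \<in> bihom i j" "G \<in> bihom i' j'"
  shows "(\<lambda>\<gamma>. F \<gamma> * G \<gamma>) \<in> bihom (i + i') (j + j')"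
proof -
  obtain N c x y where F: "\<And>k a. k < N \<Longrightarrow> a < i \<Longrightarrow> x k a \<in> f"
    "\<And>k b. k < N \<Longrightarrow> b < j \<Longrightarrow> y k b \<in> m"
    "F = fun_on (dual_space scale)
      (\<lambda>\<gamma>. \<Sum>k<(N::nat). c k * (\<Prod>a<i. \<gamma> (x k a)) * (\<Prod>b<j. \<gamma> (y k b)))"
    using assms(1) by (rule bihomE) blast
  obtain M d u v where G: "\<And>k a. k < M \<Longrightarrow> a < i' \<Longrightarrow> u k a \<in> f"
    "\<And>k b. k < M \<Longrightarrow> b < j' \<Longrightarrow> v k b \<in> m"
    "G = fun_on (dual_space scale)
      (\<lambda>\<gamma>. \<Sum>k<(M::nat). d k * (\<Prod>a<i'. \<gamma> (u k a)) * (\<Prod>b<j'. \<gamma> (v k b)))"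
    using assms(2) by (rule bihomE) blast
  have split: "(\<Prod>k<p + q. h k) = (\<Prod>k<p. h k) * (\<Prod>k<q. h (p + k))" for p q and h :: "nat \<Rightarrow> 'k"
    by (induction q) (simp_all add: mult_ac)
  let ?T = "\<lambda>k l. fun_on (dual_space scale) (\<lambda>\<gamma>. (c k * (\<Prod>a<i. \<gamma> (x k a)) * (\<Prod>b<j. \<gamma> (y k b))) *
      (d l * (\<Prod>a<i'. \<gamma> (u l a)) * (\<Prod>b<j'. \<gamma> (v l b))))"
  have "?T k l \<in> bihom (i + i') (j + j')" if "k < N" "l < M" for k l
    by (rule bihomI[where N = 1 and c = "\<lambda>_. c k * d l"
          and x = "\<lambda>_ a. if a < i then x k a else u l (a - i)"
          and y = "\<lambda>_ b. if b < j then y k b else v l (b - j)"])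
      (use F(1,2) G(1,2) that in \<open>auto simp: fun_on_def split\<close>)
  then have "(\<lambda>\<gamma>. \<Sum>k<N. \<Sum>l<M. ?T k l \<gamma>) \<in> bihom (i + i') (j + j')"
    by (intro bihom_sum) auto
  moreover have "(\<lambda>\<gamma>. \<Sum>k<N. \<Sum>l<M. ?T k l \<gamma>) = (\<lambda>\<gamma>. F \<gamma> * G \<gamma>)"
    by (auto simp: F(3) G(3) fun_on_def sum_product)
  ultimately show ?thesis by simp
qed

lemma bihom_const: "fun_on (dual_space scale) (\<lambda>_. c) \<in> bihom 0 0"
  by (rule bihomI[where N = 1 and c = "\<lambda>_. c"]) (auto simp: fun_on_def)

lemma bihom_ev_f: "x \<in> f \<Longrightarrow> ev scale x \<in> bihom 1 0"
  by (rule bihomI[where N = 1 and c = "\<lambda>_. 1" and x = "\<lambda>_ _. x"]) (auto simp: ev_apply)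

lemma bihom_ev_m: "x \<in> m \<Longrightarrow> ev scale x \<in> bihom 0 1"
  by (rule bihomI[where N = 1 and c = "\<lambda>_. 1" and y = "\<lambda>_ _. x"]) (auto simp: ev_apply)

lemma bihom_sym:
  assumes "F \<in> bihom i j"
  shows "F \<in> sym_algebra scale"
proof -
  obtain N c x y where F: "F = fun_on (dual_space scale)
      (\<lambda>\<gamma>. \<Sum>k<(N::nat). c k * (\<Prod>a<i. \<gamma> (x k a)) * (\<Prod>b<j. \<gamma> (y k b)))"
    using assms by (rule bihomE) blast
  have prod: "fun_on (dual_space scale) (\<lambda>\<gamma>. \<Prod>a<(n::nat). \<gamma> (z a)) \<in> sym_algebra scale" for n z
  proof (induction n)
    case 0
    show ?case by (simp add: sym_algebra_const)
  next
    case (Suc n)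
    have "fun_on (dual_space scale) (\<lambda>\<gamma>. \<Prod>a<Suc n. \<gamma> (z a)) =
        (\<lambda>\<gamma>. fun_on (dual_space scale) (\<lambda>\<gamma>. \<Prod>a<n. \<gamma> (z a)) \<gamma> * ev scale (z n) \<gamma>)"
      by (auto simp: fun_on_def ev_apply)
    then show ?case using Suc by (simp add: sym_algebra_mult sym_algebra_ev)
  qed
  let ?T = "\<lambda>k \<gamma>. fun_on (dual_space scale) (\<lambda>\<gamma>. \<Prod>a<i. \<gamma> (x k a)) \<gamma> *
      fun_on (dual_space scale) (\<lambda>\<gamma>. \<Prod>b<j. \<gamma> (y k b)) \<gamma>"
  have "(\<lambda>\<gamma>. \<Sum>k<N. c k * ?T k \<gamma>) \<in> sym_algebra scale"
    by (intro sym_algebra_sum sym_algebra_mult prod) auto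
  moreover have "(\<lambda>\<gamma>. \<Sum>k<N. c k * ?T k \<gamma>) = F"
    by (auto simp: F fun_on_def mult.assoc)
  ultimately show ?thesis by simp
qed

section \<open>Existence of decompositions into bi-homogeneous components\<close>

lemma ex_decomposition_single:
  assumes "F \<in> bihom i j"
  shows "\<exists>C. bihomogeneous_decomposition scale f m F C"
proof -
  let ?C = "\<lambda>i' j'. if i' = i \<and> j' = j then F else (\<lambda>_. 0)"
  have sub: "{(i', j'). ?C i' j' \<noteq> (\<lambda>_. 0)} \<subseteq> {(i, j)}" by (auto split: if_splits)
  have "(\<Sum>(i', j')\<in>{(i', j'). ?C i' j' \<noteq> (\<lambda>_. 0)}. ?C i' j' \<gamma>) = (\<Sum>(i', j')\<in>{(i, j)}. ?C i' j' \<gamma>)" for \<gamma>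
    by (rule sum.mono_neutral_left) (use sub in auto)
  then have "bihomogeneous_decomposition scale f m F ?C"
    unfolding bihomogeneous_decomposition_def
    using assms finite_subset[OF sub] by (auto simp: bihom_zero)
  then show ?thesis by blast
qed

text \<open>Cancellation can shrink the support of the sum, so all sums are first extended by zeros
  to the union of the two supports.\<close>

lemma decomposition_add:
  assumes "bihomogeneous_decomposition scale f m F C" "bihomogeneous_decomposition scale f m G D"
  shows "bihomogeneous_decomposition scale f m (\<lambda>\<gamma>. F \<gamma> + G \<gamma>) (\<lambda>i j \<gamma>. C i j \<gamma> + D i j \<gamma>)"
proof -
  let ?S = "{(i, j). C i j \<noteq> (\<lambda>_. 0)}" and ?T = "{(i, j). D i j \<noteq> (\<lambda>_. 0)}"
    and ?U = "{(i, j). (\<lambda>\<gamma>. C i j \<gamma> + D i j \<gamma>) \<noteq> (\<lambda>_. 0)}"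
  have fin: "finite (?S \<union> ?T)" using assms by (auto simp: bihomogeneous_decomposition_def)
  have sub: "?U \<subseteq> ?S \<union> ?T" by auto
  have S: "F \<gamma> = (\<Sum>(i, j)\<in>?S \<union> ?T. C i j \<gamma>)" for \<gamma>
  proof -
    have "F \<gamma> = (\<Sum>(i, j)\<in>?S. C i j \<gamma>)" using assms(1) by (simp add: bihomogeneous_decomposition_def)
    also have "\<dots> = (\<Sum>(i, j)\<in>?S \<union> ?T. C i j \<gamma>)" by (rule sum.mono_neutral_left) (use fin in auto)
    finally show ?thesis .
  qed
  have T: "G \<gamma> = (\<Sum>(i, j)\<in>?S \<union> ?T. D i j \<gamma>)" for \<gamma>
  proof -
    have "G \<gamma> = (\<Sum>(i, j)\<in>?T. D i j \<gamma>)" using assms(2) by (simp add: bihomogeneous_decomposition_def)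
    also have "\<dots> = (\<Sum>(i, j)\<in>?S \<union> ?T. D i j \<gamma>)" by (rule sum.mono_neutral_left) (use fin in auto)
    finally show ?thesis .
  qed
  have U: "(\<Sum>(i, j)\<in>?U. C i j \<gamma> + D i j \<gamma>) = (\<Sum>(i, j)\<in>?S \<union> ?T. C i j \<gamma> + D i j \<gamma>)" for \<gamma>
    by (rule sum.mono_neutral_left) (use fin sub in \<open>auto simp: fun_eq_iff\<close>)
  show ?thesis
    unfolding bihomogeneous_decomposition_def
  proof (intro conjI allI)
    show "(\<lambda>\<gamma>. C i j \<gamma> + D i j \<gamma>) \<in> bihom i j" for i j
      using assms by (simp add: bihomogeneous_decomposition_def bihom_add)
    show "finite ?U" using sub fin by (rule finite_subset)
    show "(\<lambda>\<gamma>. F \<gamma> + G \<gamma>) = (\<lambda>\<gamma>. \<Sum>(i, j)\<in>?U. C i j \<gamma> + D i j \<gamma>)"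
      unfolding S T U by (simp add: case_prod_beta sum.distrib)
  qed
qed

lemma ex_decomposition_sum:
  assumes "finite S" "\<And>q. q \<in> S \<Longrightarrow> \<exists>C. bihomogeneous_decomposition scale f m (F q) C"
  shows "\<exists>C. bihomogeneous_decomposition scale f m (\<lambda>\<gamma>. \<Sum>q\<in>S. F q \<gamma>) C"
  using assms
proof (induction S)
  case empty
  then show ?case using ex_decomposition_single[OF bihom_zero] by simp
next
  case (insert q S)
  then obtain C D where "bihomogeneous_decomposition scale f m (F q) C"
    "bihomogeneous_decomposition scale f m (\<lambda>\<gamma>. \<Sum>q\<in>S. F q \<gamma>) D" by blast
  from decomposition_add[OF this] show ?case using insert.hyps by auto
qed

text \<open>Constants have bidegree (0,0), an element of q splits into parts of bidegrees (1,0) and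
  (0,1), and a product expands into products of components, each bi-homogeneous.\<close>

lemma ex_decomposition:
  assumes "H \<in> sym_algebra scale"
  shows "\<exists>C. bihomogeneous_decomposition scale f m H C"
  using assms
proof (induction rule: sym_algebra_induct)
  case (const c)
  show ?case by (rule ex_decomposition_single[OF bihom_const])
next
  case (ev x)
  obtain C D where "bihomogeneous_decomposition scale f m (ev scale (cf x)) C"
    "bihomogeneous_decomposition scale f m (ev scale (cm x)) D"
    using ex_decomposition_single bihom_ev_f bihom_ev_m component_in by meson
  from decomposition_add[OF this]
  have "\<exists>C. bihomogeneous_decomposition scale f m (\<lambda>\<gamma>. ev scale (cf x) \<gamma> + ev scale (cm x) \<gamma>) C" by blast
  moreover have "(\<lambda>\<gamma>. ev scale (cf x) \<gamma> + ev scale (cm x) \<gamma>) = ev scale x"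
    by (auto simp: ev_apply component_sum[OF decomposition] simp flip: dual_space_simps(1))
  ultimately show ?case by simp
next
  case (add F G)
  then show ?case using decomposition_add by blast
next
  case (mult F G)
  obtain C D where C: "bihomogeneous_decomposition scale f m F C"
    and D: "bihomogeneous_decomposition scale f m G D" using mult.IH by blast
  let ?S = "{(i, j). C i j \<noteq> (\<lambda>_. 0)}" and ?T = "{(i, j). D i j \<noteq> (\<lambda>_. 0)}"
  have "\<exists>E. bihomogeneous_decomposition scale f m
      (\<lambda>\<gamma>. \<Sum>q\<in>?S. \<Sum>q'\<in>?T. C (fst q) (snd q) \<gamma> * D (fst q') (snd q') \<gamma>) E"
    using C D
    by (intro ex_decomposition_sum ex_decomposition_single[OF bihom_mult])
      (auto simp: bihomogeneous_decomposition_def)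
  moreover have "(\<lambda>\<gamma>. \<Sum>q\<in>?S. \<Sum>q'\<in>?T. C (fst q) (snd q) \<gamma> * D (fst q') (snd q') \<gamma>) = (\<lambda>\<gamma>. F \<gamma> * G \<gamma>)"
  proof -
    have "F \<gamma> = (\<Sum>q\<in>?S. C (fst q) (snd q) \<gamma>)" "G \<gamma> = (\<Sum>q\<in>?T. D (fst q) (snd q) \<gamma>)" for \<gamma>
      using C D by (simp_all add: bihomogeneous_decomposition_def case_prod_beta)
    then show ?thesis by (simp add: sum_product)
  qed
  ultimately show ?case by simp
qed


section \<open>Rescaling the two summands\<close>

text \<open>For \<gamma> in the dual space, \<open>\<gamma> \<circ> rescale r s\<close> is
  \<open>r \<gamma>\<^sub>f + s \<gamma>\<^sub>m\<close>; for \<open>r = 1\<close> it is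
  \<open>\<phi>\<^sub>s \<gamma>\<close>.\<close>

definition rescale :: "'k \<Rightarrow> 'k \<Rightarrow> 'q \<Rightarrow> 'q" where
  "rescale r s x = scale r (cf x) + scale s (cm x)"

abbreviation "pull r s \<equiv> pullback scale (rescale r s)"

lemma rescale_add: "rescale r s (x + y) = rescale r s x + rescale r s y"
  by (simp add: rescale_def component_simps scale_right_distrib add_ac)

lemma rescale_scale: "rescale r s (scale c x) = scale c (rescale r s x)"
  by (simp add: rescale_def component_simps scale_right_distrib mult.commute)

lemmas pull_closed = pullback_closed[OF rescale_add rescale_scale]
lemmas differential_pull = differential_pullback[OF rescale_add rescale_scale]

lemma dual_rescale: "\<gamma> \<in> dual_space scale \<Longrightarrow> \<gamma> \<circ> rescale r s \<in> dual_space scale"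
  by (rule dual_space_comp[OF rescale_add rescale_scale])

lemma phi_eq: "\<gamma> \<in> dual_space scale \<Longrightarrow> \<gamma> \<circ> rescale 1 s = phi f m s \<gamma>"
  by (auto simp: phi_def dual_component_def rescale_def dual_space_simps)

lemma rescale_diag: "rescale r r x = scale r x"
  by (simp add: rescale_def component_sum[OF decomposition] flip: scale_right_distrib)

text \<open>A homothety splits off. It preserves invariance, so the two-parameter family reduces to
  the maps \<open>phi\<close> applied to other invariants.\<close>

lemma pull_factor:
  assumes "r \<noteq> 0"
  shows "pull r s H = pull 1 (s / r) (pull r r H)"
proof
  fix \<gamma> :: "'q \<Rightarrow> 'k"
  have "\<gamma> \<circ> rescale r s = (\<gamma> \<circ> rescale 1 (s / r)) \<circ> rescale r r"
    using assms by (auto simp: fun_eq_iff rescale_diag) (simp add: rescale_def component_simps scale_right_distrib)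
  then show "pull r s H \<gamma> = pull 1 (s / r) (pull r r H) \<gamma>"
    by (simp add: pullback_def fun_on_def dual_rescale)
qed

lemma pull_bihom:
  assumes "F \<in> bihom i j"
  shows "pull r s F = (\<lambda>\<gamma>. r ^ i * s ^ j * F \<gamma>)"
proof
  fix \<gamma> :: "'q \<Rightarrow> 'k"
  obtain N c x y where F: "\<And>k a. k < N \<Longrightarrow> a < i \<Longrightarrow> x k a \<in> f"
    "\<And>k b. k < N \<Longrightarrow> b < j \<Longrightarrow> y k b \<in> m"
    "F = fun_on (dual_space scale)
      (\<lambda>\<gamma>. \<Sum>k<(N::nat). c k * (\<Prod>a<i. \<gamma> (x k a)) * (\<Prod>b<j. \<gamma> (y k b)))"
    using assms by (rule bihomE) blast
  show "pull r s F \<gamma> = r ^ i * s ^ j * F \<gamma>"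
  proof (cases "\<gamma> \<in> dual_space scale")
    case True
    have p: "(\<Prod>a<i. \<gamma> (rescale r s (x k a))) = r ^ i * (\<Prod>a<i. \<gamma> (x k a))"
      "(\<Prod>b<j. \<gamma> (rescale r s (y k b))) = s ^ j * (\<Prod>b<j. \<gamma> (y k b))" if "k < N" for k
      using F(1,2)[OF that] True
      by (simp_all add: rescale_def component_simps dual_space_simps prod.distrib)
    have "(\<Sum>k<N. c k * (\<Prod>a<i. \<gamma> (rescale r s (x k a))) * (\<Prod>b<j. \<gamma> (rescale r s (y k b)))) =
        (\<Sum>k<N. r ^ i * s ^ j * (c k * (\<Prod>a<i. \<gamma> (x k a)) * (\<Prod>b<j. \<gamma> (y k b))))"
      by (rule sum.cong) (simp_all add: p mult_ac)
    then show ?thesis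
      using True
      by (simp add: F(3) pullback_def fun_on_def dual_rescale
          sum_distrib_left)
  qed (simp add: F(3) pullback_def fun_on_def)
qed

lemma pull_decomposition:
  assumes "bihomogeneous_decomposition scale f m H C"
  shows "pull r s H = (\<lambda>\<gamma>. \<Sum>q\<in>{(i, j). C i j \<noteq> (\<lambda>_. 0)}. r ^ fst q * s ^ snd q * C (fst q) (snd q) \<gamma>)"
proof -
  have C: "C i j \<in> bihom i j" for i j
    using assms by (simp add: bihomogeneous_decomposition_def)
  have "H = (\<lambda>\<gamma>. \<Sum>q\<in>{(i, j). C i j \<noteq> (\<lambda>_. 0)}. C (fst q) (snd q) \<gamma>)"
    using assms by (simp add: bihomogeneous_decomposition_def case_prod_beta)
  then have "pull r s H = (\<lambda>\<gamma>. \<Sum>q\<in>{(i, j). C i j \<noteq> (\<lambda>_. 0)}. pull r s (C (fst q) (snd q)) \<gamma>)"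
    by (auto simp: pullback_def fun_on_def)
  then show ?thesis by (simp add: pull_bihom[OF C])
qed


section \<open>Invariants\<close>

abbreviation "invariants \<equiv> sym_invariants scale lp"

text \<open>The differential of \<open>ev scale x\<close> is \<open>x\<close>, so invariance places
  the differential of \<open>H\<close> at \<gamma> in the coadjoint stabilizer of \<gamma>.\<close>

lemma invariantD:
  assumes "H \<in> invariants" "\<gamma> \<in> dual_space scale"
  shows "\<gamma> (bracket (differential scale H \<gamma>) x) = 0"
proof -
  have "lp H (ev scale x) \<gamma> = 0" using assms by (simp add: sym_invariants_def)
  then show ?thesis using assms(2) by (simp add: lp_def fun_on_def differential_ev)
qed

text \<open>The differential of the pullback at \<gamma> is \<open>r\<close> times that of
  \<open>H\<close> at r \<gamma>. Moving the factor \<open>r\<close> from the bracket to the linear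
  form leaves the invariance of \<open>H\<close> at r \<gamma>.\<close>

lemma invariant_pull_diag:
  assumes "H \<in> invariants"
  shows "pull r r H \<in> invariants"
proof -
  have H: "H \<in> sym_algebra scale" using assms by (simp add: sym_invariants_def)
  have "lp (pull r r H) (ev scale x) \<gamma> = 0" for x \<gamma>
  proof (cases "\<gamma> \<in> dual_space scale")
    case True
    define X where "X = differential scale H (\<gamma> \<circ> rescale r r)"
    have "(\<gamma> \<circ> rescale r r) (bracket X x) = 0"
      unfolding X_def using assms True by (intro invariantD dual_rescale)
    then have "\<gamma> (bracket (rescale r r X) x) = 0"
      by (simp add: rescale_diag bracket_simps)
    then show ?thesis
      using True H by (simp add: lp_def fun_on_def differential_pull differential_ev X_def)
  qed (simp add: lp_def fun_on_def)
  then show ?thesis using H by (simp add: sym_invariants_def pull_closed fun_eq_iff)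
qed

text \<open>The quantity A of the overview. Since [f, f] lies in f, \<gamma> takes the same value on
  this bracket as its f-component.\<close>

definition defect where
  "defect H s H' s' \<gamma> = dual_component f m \<gamma>
     (bracket (cf (differential scale H (phi f m s \<gamma>))) (cf (differential scale H' (phi f m s' \<gamma>))))"

lemma lp_pull_defect:
  assumes H: "H \<in> invariants" and H': "H' \<in> invariants" and \<gamma>: "\<gamma> \<in> dual_space scale"
    and "s \<noteq> s'"
  shows "lp (pull 1 s H) (pull 1 s' H') \<gamma> = - ((1 - s) * (1 - s') * defect H s H' s' \<gamma>)"
proof -
  define X Y where "X = differential scale H (\<gamma> \<circ> rescale 1 s)"
    and "Y = differential scale H' (\<gamma> \<circ> rescale 1 s')"
  note XY = X_def[symmetric] Y_def[symmetric]
  have S: "H \<in> sym_algebra scale" "H' \<in> sym_algebra scale"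
    using H H' by (simp_all add: sym_invariants_def)
  note g = dual_space_simps[OF \<gamma>]
  note in_f = component_in(1) and in_m = component_in(2)
  have mf: "bracket y x \<in> m" if "x \<in> f" "y \<in> m" for x y
    using f_acts[OF that] decomposition bracket_minus[of y x]
    by (simp add: direct_decomposition_def subspace_neg)
  \<comment> \<open>Brackets of f with f lie in f and mixed ones in m, but [m, m] may have both
    components. Hence \<open>rescale 1 s\<close> fixes what contributes to \<open>?A\<close> and
    \<open>?C\<close> and multiplies by \<open>s\<close> what contributes to \<open>?B1\<close>,
    \<open>?B2\<close> and \<open>?D\<close>.\<close>
  let ?A = "\<gamma> (bracket (cf X) (cf Y))" and ?B1 = "\<gamma> (bracket (cf X) (cm Y))"
    and ?B2 = "\<gamma> (bracket (cm X) (cf Y))"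
    and ?C = "\<gamma> (cf (bracket (cm X) (cm Y)))" and ?D = "\<gamma> (cm (bracket (cm X) (cm Y)))"
  have A: "defect H s H' s' \<gamma> = ?A"
    using \<gamma> by (simp add: defect_def dual_component_def XY component_simps f_closed in_f flip: phi_eq)
  have CD: "\<gamma> (bracket (cm X) (cm Y)) = ?C + ?D"
    using g(1) component_sum[OF decomposition] by metis
  \<comment> \<open>By the chain rule the two differentials are \<open>cf X + s cm X\<close> and
    \<open>cf Y + s' cm Y\<close>; their bracket is expanded bilinearly.\<close>
  have E: "lp (pull 1 s H) (pull 1 s' H') \<gamma> = ?A + s' * ?B1 + s * ?B2 + s * s' * (?C + ?D)"
    using \<gamma> S by (simp add: lp_def fun_on_def differential_pull XY)
      (simp add: rescale_def bracket_simps g CD algebra_simps)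
  have x: "\<gamma> (rescale 1 s (bracket (cf X + cm X) z)) = 0" for z
    using invariantD[OF H dual_rescale[OF \<gamma>], of 1 s z]
    by (simp add: XY component_sum[OF decomposition])
  have y: "\<gamma> (rescale 1 s' (bracket z (cf Y + cm Y))) = 0" for z
  proof -
    have "\<gamma> (rescale 1 s' (bracket Y z)) = 0"
      using invariantD[OF H' dual_rescale[OF \<gamma>], of 1 s' z] by (simp add: XY)
    \<comment> \<open>Antisymmetry makes the argument zero; scaling by 0 in
      \<open>rescale_scale\<close> gives that \<open>rescale\<close> maps zero to zero.\<close>
    moreover have "\<gamma> (rescale 1 s' (bracket Y z + bracket z Y)) = 0"
      using rescale_scale[of 1 s' 0] by (simp add: bracket_minus[of Y z] g)
    ultimately show ?thesis by (simp add: component_sum[OF decomposition] rescale_add g)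
  qed
  note rs = rescale_def bracket_simps component_simps g in_f in_m f_closed f_acts mf
  have 1: "s * ?B2 = - ?A"
    using x[of "cf Y"] by (simp add: rs eq_neg_iff_add_eq_0 add.commute)
  have 2: "?C + s * ?D = - (s * ?B1)"
    using x[of "cm Y"] by (simp add: rs eq_neg_iff_add_eq_0 algebra_simps)
  have 3: "s' * ?B1 = - ?A"
    using y[of "cf X"] by (simp add: rs eq_neg_iff_add_eq_0 add.commute)
  have 4: "?C + s' * ?D = - (s' * ?B2)"
    using y[of "cm X"] by (simp add: rs eq_neg_iff_add_eq_0 algebra_simps)
  have alg: "a + s' * b1 + s * b2 + s * s' * (c + d) = - ((1 - s) * (1 - s') * a)"
    if 1: "s * b2 = - a" and 2: "c + s * d = - (s * b1)" and 3: "s' * b1 = - a"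
      and 4: "c + s' * d = - (s' * b2)" for a b1 b2 c d
  proof -
    \<comment> \<open>Relation 2 times \<open>s'\<close> and relation 4 times \<open>s\<close>, with
      3 and 1 inserted, read \<open>s' c + s s' d = s a\<close> and
      \<open>s c + s s' d = s' a\<close>. Eliminating \<open>d\<close>, and then \<open>c\<close>,
      leaves a factor \<open>s' - s\<close>.\<close>
    have "(s' - s) * (c + a) = 0" using 1 2 3 4 by algebra
    then have c: "c = - a" using \<open>s \<noteq> s'\<close> by (simp add: eq_neg_iff_add_eq_0)
    have "(s' - s) * (s * s' * d - (s + s') * a) = 0" using 1 2 3 4 by algebra
    then have d: "s * s' * d = (s + s') * a" using \<open>s \<noteq> s'\<close> by simp
    \<comment> \<open>The first three terms add up to \<open>- a\<close>, the last is
      \<open>- s s' a + (s + s') a\<close>.\<close>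
    show ?thesis using 1 3 c d by algebra
  qed
  show ?thesis unfolding E A by (rule alg[OF 1 2 3 4])
qed

text \<open>\<open>phi f m s \<gamma>\<close> runs through a line as \<open>s\<close> varies, and
  the defect is a linear form in the differential of \<open>H\<close>.\<close>

lemma defect_poly_left:
  assumes "H \<in> sym_algebra scale" "\<gamma> \<in> dual_space scale"
  shows "\<exists>p. \<forall>s. defect H s H' s' \<gamma> = poly p s"
proof -
  let ?l = "\<lambda>x. dual_component f m \<gamma> (bracket (cf x) (cf (differential scale H' (phi f m s' \<gamma>))))"
  note g = dual_space_simps[OF dual_component_mem[OF decomposition assms(2)]]
  have "?l \<in> dual_space scale"
    by (rule dual_spaceI) (simp_all add: component_simps bracket_simps g)
  from differential_along_line[OF assms(1) dual_component_mem[OF decomposition assms(2)]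
      dual_component_mem[OF decomposition' assms(2)] this]
  show ?thesis by (simp add: defect_def phi_def)
qed

lemma defect_poly_right:
  assumes "H' \<in> sym_algebra scale" "\<gamma> \<in> dual_space scale"
  shows "\<exists>p. \<forall>s'. defect H s H' s' \<gamma> = poly p s'"
proof -
  let ?l = "\<lambda>x. dual_component f m \<gamma> (bracket (cf (differential scale H (phi f m s \<gamma>))) (cf x))"
  note g = dual_space_simps[OF dual_component_mem[OF decomposition assms(2)]]
  have "?l \<in> dual_space scale"
    by (rule dual_spaceI) (simp_all add: component_simps bracket_simps g)
  from differential_along_line[OF assms(1) dual_component_mem[OF decomposition assms(2)]
      dual_component_mem[OF decomposition' assms(2)] this]
  show ?thesis by (simp add: defect_def phi_def)
qed


section \<open>The commutativity criterion\<close>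

definition generators where
  "generators = {C i j | H C i j. H \<in> invariants \<and> bihomogeneous_decomposition scale f m H C}"

lemma generators_sym: "generators \<subseteq> sym_algebra scale"
  unfolding generators_def by (auto simp: bihomogeneous_decomposition_def intro: bihom_sym)

text \<open>This pullback is a linear combination of components of \<open>H\<close>, with the
  scalars \<open>r ^ i * s ^ j\<close>.\<close>

lemma pull_in_Z:
  assumes "H \<in> invariants"
  shows "pull r s H \<in> gen_algebra (dual_space scale) generators"
proof -
  obtain C where C: "bihomogeneous_decomposition scale f m H C"
    using assms ex_decomposition by (auto simp: sym_invariants_def)
  show ?thesis
    unfolding pull_decomposition[OF C]
    using C assms by (intro gen_algebra_sum generators_sym)
      (auto simp: bihomogeneous_decomposition_def generators_def)
qed

text \<open>Commutativity gives the claim at once only where \<open>s\<close>, \<open>s'\<close>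
  differ from 1 and from each other. Polynomiality in \<open>s\<close> removes the exceptions 1 and
  \<open>s'\<close>; polynomiality in \<open>s'\<close> then removes 1.\<close>

lemma defect_zero_if_commutative:
  assumes comm: "\<And>F G. F \<in> gen_algebra (dual_space scale) generators \<Longrightarrow>
      G \<in> gen_algebra (dual_space scale) generators \<Longrightarrow> lp F G = (\<lambda>_. 0)"
    and H: "H \<in> invariants" and H': "H' \<in> invariants" and \<gamma>: "\<gamma> \<in> dual_space scale"
  shows "defect H s H' s' \<gamma> = 0"
proof -
  have S: "H \<in> sym_algebra scale" "H' \<in> sym_algebra scale"
    using H H' by (simp_all add: sym_invariants_def)
  have 0: "defect H s H' s' \<gamma> = 0" if "s \<noteq> 1" "s' \<noteq> 1" "s \<noteq> s'" for s s'
    using lp_pull_defect[OF H H' \<gamma> that(3)] comm[OF pull_in_Z[OF H] pull_in_Z[OF H']] that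
    by simp
  have 1: "defect H s H' s' \<gamma> = 0" if "s' \<noteq> 1" for s s'
  proof -
    obtain p where p: "\<And>s. defect H s H' s' \<gamma> = poly p s" using defect_poly_left[OF S(1) \<gamma>] by blast
    have "p = 0"
      by (rule poly_zero_cofinite[of "{1, s'}"]) (use that 0 in \<open>auto simp flip: p\<close>)
    then show ?thesis by (simp add: p)
  qed
  obtain p where p: "\<And>s'. defect H s H' s' \<gamma> = poly p s'" using defect_poly_right[OF S(2) \<gamma>] by blast
  have "p = 0"
    by (rule poly_zero_cofinite[of "{1}"]) (use 1 in \<open>auto simp flip: p\<close>)
  then show ?thesis by (simp add: p)
qed

text \<open>Brackets of components are the coefficients of the bracket of two pullbacks, viewed as a
  polynomial in \<open>r\<close>, \<open>s\<close>, \<open>r'\<close>, \<open>s'\<close>. They are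
  extracted first in \<open>r\<close>, \<open>s\<close>, then in \<open>r'\<close>,
  \<open>s'\<close>.\<close>

lemma generators_commute_if_defect_zero:
  assumes zero: "\<And>\<gamma> s s' H H'. \<gamma> \<in> dual_space scale \<Longrightarrow> s \<noteq> 0 \<Longrightarrow> s' \<noteq> 0 \<Longrightarrow>
      H \<in> invariants \<Longrightarrow> H' \<in> invariants \<Longrightarrow> defect H s H' s' \<gamma> = 0"
    and "F \<in> generators" "F' \<in> generators"
  shows "lp F F' = (\<lambda>_. 0)"
proof
  fix \<gamma>
  obtain H C i j where H: "H \<in> invariants" and C: "bihomogeneous_decomposition scale f m H C"
    and F: "F = C i j" using assms(2) by (auto simp: generators_def)
  obtain H' C' i' j' where H': "H' \<in> invariants" and C': "bihomogeneous_decomposition scale f m H' C'"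
    and F': "F' = C' i' j'" using assms(3) by (auto simp: generators_def)
  let ?S = "{(i, j). C i j \<noteq> (\<lambda>_. 0)}" and ?T = "{(i, j). C' i j \<noteq> (\<lambda>_. 0)}"
  have fin: "finite ?S" "finite ?T" using C C' by (auto simp: bihomogeneous_decomposition_def)
  have sym: "C i j \<in> sym_algebra scale" "C' i j \<in> sym_algebra scale" for i j
    using C C' bihom_sym[of "C i j" i j] bihom_sym[of "C' i j" i j]
    by (simp_all add: bihomogeneous_decomposition_def)
  show "lp F F' \<gamma> = 0"
  \<comment> \<open>Coefficient comparison reaches only indices in the supports; otherwise a
    component is zero and the bracket vanishes.\<close>
  proof (cases "\<gamma> \<in> dual_space scale \<and> (i, j) \<in> ?S \<and> (i', j') \<in> ?T")
    case True
    then have \<gamma>: "\<gamma> \<in> dual_space scale" by simp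
    \<comment> \<open>After factoring out homotheties the parameters are \<open>s / r\<close> and
      \<open>s' / r'\<close>: nonzero, so the defect vanishes, and distinct, as
      \<open>lp_pull_defect\<close> demands.\<close>
    have pulls: "lp (pull r s H) (pull r' s' H') \<gamma> = 0"
      if "r \<noteq> 0" "s \<noteq> 0" "r' \<noteq> 0" "s' \<noteq> 0" "s \<noteq> r * (s' / r')" for r s r' s'
    proof -
      have "s / r \<noteq> s' / r'" using that by (auto simp: field_simps)
      then show ?thesis
        using that lp_pull_defect[OF invariant_pull_diag[OF H] invariant_pull_diag[OF H'] \<gamma>]
          zero[OF \<gamma> _ _ invariant_pull_diag[OF H] invariant_pull_diag[OF H']]
        by (simp add: pull_factor[of r s] pull_factor[of r' s'])
    qed
    have 1: "lp (C i j) (pull r' s' H') \<gamma> = 0" if "r' \<noteq> 0" "s' \<notin> {0}" for r' s'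
    proof (rule power_sum2_coeff_zero[where S = ?S and B = "\<lambda>r. {0, r * (s' / r')}"
          and c = "\<lambda>i j. lp (C i j) (pull r' s' H') \<gamma>"])
      show "(\<Sum>(i, j)\<in>?S. r ^ i * s ^ j * lp (C i j) (pull r' s' H') \<gamma>) = 0"
        if "r \<noteq> 0" "s \<notin> {0, r * (s' / r')}" for r s
        using pulls[of r s r' s'] that \<open>r' \<noteq> 0\<close> \<open>s' \<notin> {0}\<close>
        unfolding pull_decomposition[OF C] lp_sum[OF fin(1) sym(1)]
        by (simp add: case_prod_beta)
    qed (use fin True in auto)
    show ?thesis
      unfolding F F'
    proof (rule power_sum2_coeff_zero[where S = ?T and B = "\<lambda>_. {0}"
          and c = "\<lambda>i' j'. lp (C i j) (C' i' j') \<gamma>"])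
      show "(\<Sum>(i', j')\<in>?T. r' ^ i' * s' ^ j' * lp (C i j) (C' i' j') \<gamma>) = 0"
        if "r' \<noteq> 0" "s' \<notin> {0}" for r' s'
        using 1[OF that]
        unfolding pull_decomposition[OF C'] lp_sum_right[OF fin(2) sym(2)]
        by (simp add: case_prod_beta)
    qed (use fin True in auto)
  next
    case False
    have "lp (\<lambda>_. 0) F' \<gamma> = 0" using lp_scale[OF zero_in_sym_algebra, of 0 F'] by simp
    then show ?thesis using False by (auto simp: F F' lp_zero_right) (simp add: lp_def fun_on_def)
  qed
qed

theorem commutative_iff:
  "poisson_commutative lp (gen_algebra (dual_space scale) generators) \<longleftrightarrow>
    (\<forall>\<gamma> \<in> dual_space scale. \<forall>s s'. s \<noteq> 0 \<longrightarrow> s' \<noteq> 0 \<longrightarrow>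
      (\<forall>H \<in> invariants. \<forall>H' \<in> invariants. defect H s H' s' \<gamma> = 0))"
proof
  assume "poisson_commutative lp (gen_algebra (dual_space scale) generators)"
  then show "\<forall>\<gamma> \<in> dual_space scale. \<forall>s s'. s \<noteq> 0 \<longrightarrow> s' \<noteq> 0 \<longrightarrow>
      (\<forall>H \<in> invariants. \<forall>H' \<in> invariants. defect H s H' s' \<gamma> = 0)"
    using defect_zero_if_commutative by (simp add: poisson_commutative_def)
next
  assume zero: "\<forall>\<gamma> \<in> dual_space scale. \<forall>s s'. s \<noteq> 0 \<longrightarrow> s' \<noteq> 0 \<longrightarrow>
      (\<forall>H \<in> invariants. \<forall>H' \<in> invariants. defect H s H' s' \<gamma> = 0)"
  have "lp F G = (\<lambda>_. 0)" if "F \<in> generators" "G \<in> generators" for F G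
    using zero that by (intro generators_commute_if_defect_zero) auto
  then show "poisson_commutative lp (gen_algebra (dual_space scale) generators)"
    using gen_algebra_lp_zero[OF generators_sym] by (simp add: poisson_commutative_def)
qed

end

theorem theorem2p1:
  fixes scale :: "'k::{alg_closed_field, field_char_0} \<Rightarrow> 'q::ab_group_add \<Rightarrow> 'q"
    and bracket :: "'q \<Rightarrow> 'q \<Rightarrow> 'q"
    and n :: nat and G :: "(nat \<Rightarrow> 'k) monoid"
    and f m :: "'q set"
    and P :: "(('q \<Rightarrow> 'k) \<Rightarrow> 'k) \<Rightarrow> (('q \<Rightarrow> 'k) \<Rightarrow> 'k) \<Rightarrow> ('q \<Rightarrow> 'k) \<Rightarrow> 'k"
  assumes "lie_algebra scale bracket"
    and "affine_algebraic_group n G" and "zariski_connected n (carrier G)"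
    and "is_lie_algebra_of_group scale bracket n G"
    and "direct_decomposition scale f m"
    and "\<forall>x\<in>f. \<forall>y\<in>f. bracket x y \<in> f"
    and "\<forall>x\<in>f. \<forall>y\<in>m. bracket x y \<in> m"
    and "lie_poisson_bracket scale bracket P"
  shows "poisson_commutative P (Z_algebra scale P f m) \<longleftrightarrow>
    (\<forall>\<gamma> \<in> dual_space scale. \<forall>s s'. s \<noteq> 0 \<longrightarrow> s' \<noteq> 0 \<longrightarrow>
      (\<forall>H \<in> sym_invariants scale P. \<forall>H' \<in> sym_invariants scale P.
        dual_component f m \<gamma>
          (bracket (component f m (differential scale H (phi f m s \<gamma>)))
                   (component f m (differential scale H' (phi f m s' \<gamma>)))) = 0))"
proof -
  interpret lie_algebra scale bracket by fact
  interpret decomposed_lie_algebra scale bracket f m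
    by unfold_locales (use assms in auto)
  \<comment> \<open>\<open>P\<close> is determined only on the symmetric algebra. The invariants and
    the algebra they generate through their components lie inside it, so \<open>P\<close> can be
    replaced by \<open>lp\<close> throughout.\<close>
  have P: "P F F' = lp F F'" if "F \<in> sym_algebra scale" "F' \<in> sym_algebra scale" for F F'
    using lie_poisson_bracket_unique assms(8) that by blast
  then have inv: "sym_invariants scale P = invariants"
    by (auto simp: sym_invariants_def sym_algebra_ev)
  then have Z: "Z_algebra scale P f m = gen_algebra (dual_space scale) generators"
    by (simp add: Z_algebra_def generators_def)
  have "P F F' = lp F F'" if "F \<in> Z_algebra scale P f m" "F' \<in> Z_algebra scale P f m" for F F'
    using gen_algebra_subset[OF generators_sym] that by (intro P) (auto simp: Z)
  then have "poisson_commutative P (Z_algebra scale P f m) \<longleftrightarrow>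
      poisson_commutative lp (Z_algebra scale P f m)"
    by (simp add: poisson_commutative_def)
  then show ?thesis
    using commutative_iff by (simp add: Z inv defect_def)
qed

end
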